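(* Fix an integer $q\geq 1$. For all integers $N\geq 2$ we have \[\sqrt{\frac{q(q+2) n}{12}}\,\frac{1}{(1+q)^n} \binom{n}{k}^{(q)}=\frac{1}{\sqrt{2 \pi}} e^{-x^2/2}+\sum_{\nu=1}^{\left[(N-2)/2\right]} \frac{q_{2\nu}(x)}{n^{\nu}} +o\left(\frac{1}{n^{(N-2)/2}}\right)\] as $n\rightarrow \infty$, uniformly with respect to all $k\in\mathbb{Z}$, where \[x=\frac{\sqrt{12}}{\sqrt{q(q+2) n}}\left(k-\frac{q}{2}n\right),\] and for positive integers $\nu$, \[q_{2\nu} (x) = \frac{1}{\sqrt{2 \pi}} \left(\frac{12}{q(q+2)}\right)^{\nu} e^{-x^2 / 2}\sum_{\substack{k_2, k_4, \ldots, k_{2\nu} \geq 0 \\ k_2 + 2 k_4 + \cdots + \nu k_{2\nu} = \nu}} H_{2(\nu + s)} (x) \left(\frac{6}{q(q+2)}\right)^s \prod_{m=1}^{\nu} \frac{1}{k_{2m}!} \left( \frac{\mathcal{B}_{2(m+1)} \left((q+1)^{2m+2}-1\right)}{(2m+2)!\, (m+1) } \right)^{k_{2m}},\] with $s=k_2+k_4+\cdots+k_{2\nu}$.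
   Context: For $n,q\in\mathbb{N}=\{1,2,\ldots\}$ the extended binomial coefficients $\binom{n}{k}^{(q)}$ are defined by $\sum_{k=0}^{\infty}\binom{n}{k}^{(q)} x^k = (1+x+x^2+\cdots+x^{q})^n$, and $\binom{n}{k}^{(q)}=0$ for integers $k<0$. $H_m(x)=(-1)^m e^{x^2/2}\frac{d^m}{dx^m}e^{-x^2/2}$ are the (probabilists') Hermite polynomials. $\mathcal{B}_j$ denote the Bernoulli numbers (so $\mathcal{B}_2=1/6$, $\mathcal{B}_4=-1/30$), e.g. defined by $\frac{z}{e^z-1}=\sum_{j\ge0}\mathcal{B}_j\frac{z^j}{j!}$. $[\cdot]$ denotes the integer part; an empty sum is zero. *)

theory Defs
  imports "HOL-Analysis.Analysis" "HOL-Computational_Algebra.Polynomial"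
          "HOL-Computational_Algebra.Formal_Power_Series"
begin

definition ext_binom :: "nat \<Rightarrow> nat \<Rightarrow> int \<Rightarrow> real" where
  "ext_binom q n k =
     (if k < 0 then 0 else coeff ((\<Sum>i\<le>q. monom (1::real) i) ^ n) (nat k))"

text \<open>Probabilists' Hermite polynomials via Rodrigues' formula.\<close>
definition hermite :: "nat \<Rightarrow> real \<Rightarrow> real" where
  "hermite m x = (-1) ^ m * exp (x^2 / 2) * (deriv ^^ m) (\<lambda>t. exp (- (t^2) / 2)) x"

definition bernoulli_num :: "nat \<Rightarrow> real" where
  "bernoulli_num j = fact j * fps_nth (fps_X / (fps_exp 1 - 1)) j"

text \<open>Tuples (k_2,k_4,...,k_{2 nu}) encoded as kv m = k_{2m} for 1 \<le> m \<le> nu, 0 elsewhere.\<close>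
definition partition_tuples :: "nat \<Rightarrow> (nat \<Rightarrow> nat) set" where
  "partition_tuples \<nu> = {kv. (\<forall>m. m \<notin> {1..\<nu>} \<longrightarrow> kv m = 0) \<and> (\<Sum>m=1..\<nu>. m * kv m) = \<nu>}"

definition q_coeff :: "nat \<Rightarrow> nat \<Rightarrow> real \<Rightarrow> real" where
  "q_coeff q \<nu> x =
     1 / sqrt (2 * pi) * (12 / (real q * (real q + 2))) ^ \<nu> * exp (- (x^2) / 2) *
     (\<Sum>kv\<in>partition_tuples \<nu>.
        (let s = (\<Sum>m=1..\<nu>. kv m) in
          hermite (2 * (\<nu> + s)) x * (6 / (real q * (real q + 2))) ^ s *
          (\<Prod>m=1..\<nu>. 1 / fact (kv m) *
             (bernoulli_num (2 * (m + 1)) * ((real q + 1) ^ (2 * m + 2) - 1)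
               / (fact (2 * m + 2) * real (m + 1))) ^ kv m)))"

end

theory Submission
  imports Defs "HOL-Probability.Probability" "HOL-Complex_Analysis.Complex_Analysis"
          "HOL-Real_Asymp.Real_Asymp"
begin

text \<open>
  By Fourier inversion, the normalised coefficient is an integral over \<open>[-\<pi>, \<pi>]\<close> of
  \<open>D t ^ n * cos (t * y)\<close>, where \<open>D\<close> is the real characteristic function of the centred uniform
  distribution on \<open>{0..q}\<close> and \<open>y = k - q * n / 2\<close>. Near 0 one has
  \<open>D t = exp (- s * t\<^sup>2 / 2 + t\<^sup>2 * \<psi> (t\<^sup>2))\<close> with \<open>s = q * (q + 2) / 12\<close>, where \<open>\<psi>\<close> is holomorphic,
  \<open>\<psi> 0 = 0\<close>, and its coefficients are given by Bernoulli numbers (compare the logarithmic derivative of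
  \<open>(exp ((q + 1) * z) - 1) / (exp z - 1)\<close> with the generating function of the Bernoulli numbers).
  With \<open>v = n * t\<^sup>2\<close> this gives \<open>D t ^ n = exp (- s * v / 2) * exp (v * \<psi> (t\<^sup>2))\<close>. Cauchy's inequalities
  bound the Taylor remainder of \<open>w \<mapsto> exp (v * \<psi> w)\<close> uniformly in \<open>v\<close>, and what they leave is
  dominated by \<open>exp (- s * v / 4) * t ^ (2 * M + 2)\<close>, whose integral is of order \<open>n powr (- M - 3 / 2)\<close>.
  Away from 0 both \<open>D t ^ n\<close> and the Gaussian terms are negligible. Finally, the Fourier integrals of
  even Gaussian moments are Hermite functions, so each Taylor term yields one \<open>q_coeff\<close>.
\<close>

section \<open>Taylor coefficients of exponentials\<close>

text \<open>A nonzero entry at an index above \<open>\<nu>\<close> would alone push the weighted sum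
  past \<open>\<nu>\<close>. Tuples of different weights can therefore share one index range, as
  comparing weight \<open>\<nu>\<close> with weight \<open>\<nu> - m\<close> requires.\<close>

lemma partition_tuples_altdef:
  assumes "\<nu> \<le> N"
  shows "partition_tuples \<nu> =
           {kv. (\<forall>m. m \<notin> {1..N} \<longrightarrow> kv m = 0) \<and> (\<Sum>m=1..N. m * kv m) = \<nu>}"
proof (intro set_eqI iffI; clarify?)
  fix kv assume kv: "kv \<in> partition_tuples \<nu>"
  have "(\<Sum>m=1..N. m * kv m) = (\<Sum>m=1..\<nu>. m * kv m)"
    using kv assms by (intro sum.mono_neutral_right) (auto simp: partition_tuples_def)
  then show "(\<forall>m. m \<notin> {1..N} \<longrightarrow> kv m = 0) \<and> (\<Sum>m=1..N. m * kv m) = \<nu>"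
    using kv assms by (auto simp: partition_tuples_def)
next
  fix kv :: "nat \<Rightarrow> nat"
  assume *: "\<forall>m. m \<notin> {1..N} \<longrightarrow> kv m = 0" and sum: "\<nu> = (\<Sum>m=1..N. m * kv m)"
  have zero: "kv m = 0" if "m \<notin> {1..\<nu>}" for m
  proof (cases "m \<in> {1..N}")
    case True
    have "m * kv m \<le> (\<Sum>m=1..N. m * kv m)"
      by (rule member_le_sum[OF True]) auto
    with that True sum show ?thesis by (cases "kv m") auto
  qed (use * in auto)
  have "(\<Sum>m=1..N. m * kv m) = (\<Sum>m=1..\<nu>. m * kv m)"
    using zero assms by (intro sum.mono_neutral_right) auto
  with zero sum show "kv \<in> partition_tuples (\<Sum>m=1..N. m * kv m)"
    unfolding partition_tuples_def by auto
qed

lemma finite_partition_tuples: "finite (partition_tuples \<nu>)"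
proof (rule finite_subset)
  show "partition_tuples \<nu> \<subseteq>
          {kv. \<forall>m. (m \<in> {1..\<nu>} \<longrightarrow> kv m \<in> {..\<nu>}) \<and> (m \<notin> {1..\<nu>} \<longrightarrow> kv m = 0)}"
  proof (intro subsetI CollectI allI conjI impI)
    fix kv m assume kv: "kv \<in> partition_tuples \<nu>" and m: "m \<in> {1..\<nu>}"
    have "kv m \<le> m * kv m" using m by simp
    also have "\<dots> \<le> (\<Sum>m=1..\<nu>. m * kv m)" by (rule member_le_sum[OF m]) auto
    finally show "kv m \<in> {..\<nu>}" using kv by (simp add: partition_tuples_def)
  qed (auto simp: partition_tuples_def)
qed (rule finite_set_of_finite_funs; simp)

text \<open>This is the coefficient of \<open>w ^ \<nu>\<close> in the exponential of the series
  with coefficients \<open>a m\<close>, \<open>m \<ge> 1\<close> (a complete Bell polynomial over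
  \<open>fact \<nu>\<close>). The sum over tuples mirrors the shape of
  \<open>q_coeff\<close>.\<close>

definition exp_coeff :: "(nat \<Rightarrow> 'a :: field_char_0) \<Rightarrow> nat \<Rightarrow> 'a" where
  "exp_coeff a \<nu> = (\<Sum>kv\<in>partition_tuples \<nu>. \<Prod>m=1..\<nu>. a m ^ kv m / fact (kv m))"

lemma exp_coeff_0 [simp]: "exp_coeff a 0 = 1"
proof -
  have "partition_tuples 0 = {\<lambda>_. 0}" by (auto simp: partition_tuples_def)
  then show ?thesis by (simp add: exp_coeff_def)
qed

lemma exp_coeff_altdef:
  assumes "\<nu> \<le> N"
  shows "exp_coeff a \<nu> = (\<Sum>kv\<in>partition_tuples \<nu>. \<Prod>m=1..N. a m ^ kv m / fact (kv m))"
  unfolding exp_coeff_def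
  using assms by (intro sum.cong prod.mono_neutral_left refl) (auto simp: partition_tuples_def)

text \<open>Coefficient form of \<open>E' = A' * E\<close> for \<open>E = exp A\<close>. Each tuple
  is weighted by \<open>\<nu>\<close>, written as the sum of \<open>m * kv m\<close>; for fixed
  \<open>m\<close>, lowering \<open>kv m\<close> by one is a bijection onto the tuples of weight
  \<open>\<nu> - m\<close> and absorbs the factor \<open>kv m\<close> into the factorial.\<close>

lemma exp_coeff_rec:
  fixes a :: "nat \<Rightarrow> 'a :: field_char_0"
  shows "of_nat \<nu> * exp_coeff a \<nu> = (\<Sum>m=1..\<nu>. of_nat m * a m * exp_coeff a (\<nu> - m))"
proof -
  define w where "w = (\<lambda>kv. \<Prod>m=1..\<nu>. a m ^ kv m / fact (kv m))"
  have remove: "(\<Sum>kv\<in>partition_tuples \<nu>. of_nat (kv m) * w kv) = a m * exp_coeff a (\<nu> - m)"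
    if m: "m \<in> {1..\<nu>}" for m
  proof -
    \<comment> \<open>Each side carries the entry that the other one replaces, so no truncated
      subtraction of naturals occurs.\<close>
    have sum_upd: "(\<Sum>i=1..\<nu>. i * (kv(m := k)) i) + m * kv m = m * k + (\<Sum>i=1..\<nu>. i * kv i)"
      for kv :: "nat \<Rightarrow> nat" and k
    proof -
      have "(\<Sum>i\<in>{1..\<nu>} - {m}. i * (kv(m := k)) i) = (\<Sum>i\<in>{1..\<nu>} - {m}. i * kv i)"
        by (intro sum.cong) auto
      then show ?thesis
        using sum.remove[OF _ m, of "\<lambda>i. i * (kv(m := k)) i"] sum.remove[OF _ m, of "\<lambda>i. i * kv i"]
        by simp
    qed
    have split_prod: "w kv = a m ^ kv m / fact (kv m) * (\<Prod>i\<in>{1..\<nu>} - {m}. a i ^ kv i / fact (kv i))"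
      for kv unfolding w_def using m by (simp add: prod.remove)
    \<comment> \<open>Tuples with \<open>kv m = 0\<close> contribute nothing; dropping them makes
      the decrement invertible.\<close>
    have "(\<Sum>kv\<in>partition_tuples \<nu>. of_nat (kv m) * w kv) =
            (\<Sum>kv\<in>{kv \<in> partition_tuples \<nu>. kv m \<noteq> 0}. of_nat (kv m) * w kv)"
      by (intro sum.mono_neutral_right finite_partition_tuples) auto
    also have "\<dots> = (\<Sum>kv\<in>partition_tuples (\<nu> - m). a m * w kv)"
    proof (rule sum.reindex_bij_witness[where i = "\<lambda>kv. kv(m := Suc (kv m))"
                                          and j = "\<lambda>kv. kv(m := kv m - 1)"])
      fix kv assume "kv \<in> {kv \<in> partition_tuples \<nu>. kv m \<noteq> 0}"
      then obtain k where kv: "kv \<in> partition_tuples \<nu>" "kv m = Suc k" using not0_implies_Suc by auto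
      then show "(kv(m := kv m - 1))(m := Suc ((kv(m := kv m - 1)) m)) = kv" by auto
      show "kv(m := kv m - 1) \<in> partition_tuples (\<nu> - m)"
        using kv m sum_upd[of kv k]
        by (subst partition_tuples_altdef[of _ \<nu>]) (auto simp: partition_tuples_def)
      have "of_nat (Suc k) / fact (Suc k) = (1 / fact k :: 'a)"
        by (simp add: divide_simps del: of_nat_Suc)
      then show "a m * w (kv(m := kv m - 1)) = of_nat (kv m) * w kv"
        using kv(2) by (simp add: split_prod divide_simps del: of_nat_Suc)
    next
      fix kv assume kv: "kv \<in> partition_tuples (\<nu> - m)"
      show "(kv(m := Suc (kv m)))(m := (kv(m := Suc (kv m))) m - 1) = kv" by auto
      show "kv(m := Suc (kv m)) \<in> {kv \<in> partition_tuples \<nu>. kv m \<noteq> 0}"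
        using kv m sum_upd[of kv "Suc (kv m)"]
        by (subst (asm) partition_tuples_altdef[of _ \<nu>]) (auto simp: partition_tuples_def)
    qed
    also have "\<dots> = a m * exp_coeff a (\<nu> - m)"
      by (simp add: exp_coeff_altdef[of "\<nu> - m" \<nu>] w_def sum_distrib_left)
    finally show ?thesis .
  qed
  have "of_nat \<nu> * exp_coeff a \<nu> = (\<Sum>kv\<in>partition_tuples \<nu>. of_nat \<nu> * w kv)"
    by (simp add: exp_coeff_def w_def sum_distrib_left)
  also have "\<dots> = (\<Sum>kv\<in>partition_tuples \<nu>. \<Sum>m=1..\<nu>. of_nat m * (of_nat (kv m) * w kv))"
  proof (rule sum.cong)
    fix kv assume "kv \<in> partition_tuples \<nu>"
    then have "of_nat \<nu> = (\<Sum>m=1..\<nu>. of_nat m * of_nat (kv m) :: 'a)"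
      by (simp add: partition_tuples_def flip: of_nat_mult of_nat_sum)
    then show "of_nat \<nu> * w kv = (\<Sum>m=1..\<nu>. of_nat m * (of_nat (kv m) * w kv))"
      by (simp add: sum_distrib_right mult.assoc)
  qed simp
  also have "\<dots> = (\<Sum>m=1..\<nu>. of_nat m * (\<Sum>kv\<in>partition_tuples \<nu>. of_nat (kv m) * w kv))"
    by (subst sum.swap) (simp add: sum_distrib_left)
  also have "\<dots> = (\<Sum>m=1..\<nu>. of_nat m * a m * exp_coeff a (\<nu> - m))"
    by (intro sum.cong) (auto simp: remove mult.assoc)
  finally show ?thesis .
qed

text \<open>Differentiating the composition yields the recurrence \<open>exp_coeff_rec\<close>, and
  both sides start with 1, so strong induction identifies them.\<close>

lemma fps_exp_compose_nth:
  fixes F :: "'a :: field_char_0 fps"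
  assumes "fps_nth F 0 = 0"
  shows "fps_nth (fps_exp c oo F) \<nu> = exp_coeff (\<lambda>m. c * fps_nth F m) \<nu>"
proof (induction \<nu> rule: less_induct)
  case (less \<nu>)
  show ?case
  proof (cases \<nu>)
    case (Suc n)
    have "fps_nth (fps_deriv (fps_exp c oo F)) n = fps_nth (fps_const c * (fps_exp c oo F) * fps_deriv F) n"
      using assms by (simp add: fps_compose_deriv fps_const_mult_apply_left flip: fps_compose_mult_distrib)
    then have "of_nat \<nu> * fps_nth (fps_exp c oo F) \<nu> =
            (\<Sum>i=0..n. c * fps_nth (fps_exp c oo F) i * (of_nat (\<nu> - i) * fps_nth F (\<nu> - i)))"
      by (simp add: Suc fps_mult_nth[of _ "fps_deriv F"] Suc_diff_le del: of_nat_Suc)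
    also have "\<dots> = (\<Sum>i=0..n. of_nat (\<nu> - i) * (c * fps_nth F (\<nu> - i)) * exp_coeff (\<lambda>m. c * fps_nth F m) i)"
      by (intro sum.cong) (auto simp: less Suc)
    also have "\<dots> = (\<Sum>m=1..\<nu>. of_nat m * (c * fps_nth F m) * exp_coeff (\<lambda>m. c * fps_nth F m) (\<nu> - m))"
      by (rule sum.reindex_bij_witness[of _ "\<lambda>m. \<nu> - m" "\<lambda>m. \<nu> - m"]) (auto simp: Suc)
    also have "\<dots> = of_nat \<nu> * exp_coeff (\<lambda>m. c * fps_nth F m) \<nu>"
      by (rule exp_coeff_rec[symmetric])
    finally show ?thesis by (simp add: Suc del: of_nat_Suc)
  qed simp
qed

section \<open>Fourier inversion\<close>

definition unif_char :: "nat \<Rightarrow> real \<Rightarrow> real" where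
  "unif_char q t = (\<Sum>j\<le>q. cos (t * (real j - real q / 2))) / (1 + real q)"

text \<open>The reflection \<open>j \<mapsto> q - j\<close> changes the sign of every sine, so the
  imaginary part cancels; this is why \<open>unif_char\<close> can be defined with cosines
  only.\<close>

lemma sum_cis_eq_unif_char:
  "(\<Sum>j\<le>q. cis (t * (real j - real q / 2))) = of_real ((1 + real q) * unif_char q t)"
proof -
  have "(\<Sum>j\<le>q. sin (t * (real j - real q / 2))) = (\<Sum>j\<le>q. sin (t * (real (q - j) - real q / 2)))"
    by (rule sum.reindex_bij_witness[of _ "\<lambda>j. q - j" "\<lambda>j. q - j"]) auto
  also have "\<dots> = (\<Sum>j\<le>q. - sin (t * (real j - real q / 2)))"
  proof (intro sum.cong refl)
    fix j assume "j \<in> {..q}"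
    then have "t * (real (q - j) - real q / 2) = - (t * (real j - real q / 2))"
      by (simp add: of_nat_diff field_simps)
    then show "sin (t * (real (q - j) - real q / 2)) = - sin (t * (real j - real q / 2))"
      by (simp only: sin_minus)
  qed
  finally have "(\<Sum>j\<le>q. sin (t * (real j - real q / 2))) = 0"
    by (simp add: sum_negf)
  moreover have "1 + real q \<noteq> 0" by linarith
  ultimately show ?thesis
    by (simp add: complex_eq_iff unif_char_def)
qed

lemma coeff_of_real_sum_monom_power:
  "coeff ((\<Sum>i\<le>q. monom (1 :: complex) i) ^ n) j = of_real (coeff ((\<Sum>i\<le>q. monom (1 :: real) i) ^ n) j)"
proof (induction n arbitrary: j)
  case (Suc n)
  have "coeff (\<Sum>i\<le>q. monom (1 :: complex) i) j = of_real (coeff (\<Sum>i\<le>q. monom (1 :: real) i) j)" for j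
    by (simp add: coeff_sum if_distrib[of of_real])
  with Suc show ?case by (simp add: coeff_mult)
qed auto

lemma integral_cos_int_period:
  "(\<integral>t. indicator {-pi..pi} t * cos (t * of_int m) \<partial>lborel) = (if m = 0 then 2 * pi else 0)"
proof (cases "m = 0")
  case False
  have "(\<integral>t. indicator {-pi..pi} t *\<^sub>R cos (t * of_int m) \<partial>lborel) =
          sin (pi * of_int m) / of_int m - sin (- pi * of_int m) / of_int m"
    using False by (intro integral_FTC_Icc)
       (auto intro!: derivative_eq_intros continuous_intros simp flip: has_real_derivative_iff_has_vector_derivative)
  with False show ?thesis by (simp add: sin_zero_iff_int2 mult.commute)
qed simp

text \<open>The generating polynomial at \<open>cis t\<close> is a phase times a power of
  \<open>unif_char q t\<close>. Multiplying by \<open>cis (- t * k)\<close> and integrating over a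
  period isolates the coefficient of index \<open>k\<close>.\<close>

lemma ext_binom_fourier:
  "1 / (1 + real q) ^ n * ext_binom q n k =
     (\<integral>t. indicator {-pi..pi} t * (unif_char q t ^ n * cos (t * (real_of_int k - real q / 2 * real n))) \<partial>lborel)
       / (2 * pi)"
proof -
  define P where "P = (\<Sum>i\<le>q. monom (1 :: real) i) ^ n"
  define Q where "Q = (\<Sum>i\<le>q. monom (1 :: complex) i) ^ n"
  define y where "y = real_of_int k - real q / 2 * real n"
  have PQ: "coeff Q j = of_real (coeff P j)" for j
    unfolding P_def Q_def by (rule coeff_of_real_sum_monom_power)
  \<comment> \<open>The sums below stop at \<open>degree Q\<close>, since the complex polynomial is
    the one being evaluated; beyond it the real coefficients vanish too, which covers large
    \<open>k\<close>.\<close>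
  have deg: "coeff P j = 0" if "j > degree Q" for j
    using coeff_eq_0[OF that] PQ[of j] by simp
  have eq: "(1 + real q) ^ n * (unif_char q t ^ n * cos (t * y)) =
          (\<Sum>j\<le>degree Q. coeff P j * cos (t * of_int (int j - k)))" for t
  proof -
    have "poly Q (cis t) = (\<Sum>i\<le>q. cis t ^ i) ^ n"
      by (simp add: Q_def poly_sum poly_monom)
    also have "\<dots> = (\<Sum>i\<le>q. cis (t * real q / 2) * cis (t * (real i - real q / 2))) ^ n"
      by (simp add: Complex.DeMoivre cis_mult algebra_simps)
    also have "\<dots> = (cis (t * real q / 2) * of_real ((1 + real q) * unif_char q t)) ^ n"
      by (simp only: sum_cis_eq_unif_char flip: sum_distrib_left)
    also have "\<dots> = cis (t * real q / 2 * real n) * of_real (((1 + real q) * unif_char q t) ^ n)"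
      by (simp add: power_mult_distrib Complex.DeMoivre mult.commute)
    finally have "cis (- t * of_int k) * poly Q (cis t) =
        cis (- t * y) * of_real (((1 + real q) * unif_char q t) ^ n)"
      by (simp only: mult.assoc[symmetric] cis_mult) (simp add: y_def algebra_simps)
    moreover have "cis (- t * of_int k) * poly Q (cis t) =
             (\<Sum>j\<le>degree Q. of_real (coeff P j) * cis (t * of_int (int j - k)))"
      unfolding poly_altdef PQ sum_distrib_left
    proof (intro sum.cong refl)
      fix j
      have "cis (- t * of_int k) * cis t ^ j = cis (t * of_int (int j - k))"
        by (simp add: Complex.DeMoivre cis_mult algebra_simps)
      then show "cis (- t * of_int k) * (of_real (coeff P j) * cis t ^ j) =
                   of_real (coeff P j) * cis (t * of_int (int j - k))"
        by (simp only: mult.left_commute)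
    qed
    ultimately have "Re (cis (- t * y) * of_real (((1 + real q) * unif_char q t) ^ n)) =
           Re (\<Sum>j\<le>degree Q. of_real (coeff P j) * cis (t * of_int (int j - k)))"
      by simp
    then show ?thesis by (simp add: power_mult_distrib mult_ac)
  qed
  have int: "integrable lborel (\<lambda>t. indicator {-pi..pi} t * cos (t * of_int m))" for m
  proof -
    have "continuous_on {-pi..pi} (\<lambda>t. cos (t * of_int m))" by (intro continuous_intros)
    from borel_integrable_atLeastAtMost'[OF this] show ?thesis by (simp add: set_integrable_def)
  qed
  have "(1 + real q) ^ n * (\<integral>t. indicator {-pi..pi} t * (unif_char q t ^ n * cos (t * y)) \<partial>lborel) =
          (\<integral>t. indicator {-pi..pi} t * ((1 + real q) ^ n * (unif_char q t ^ n * cos (t * y))) \<partial>lborel)"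
    by (subst integral_mult_right_zero[symmetric]) (simp only: mult_ac)
  also have "\<dots> = (\<integral>t. (\<Sum>j\<le>degree Q. coeff P j * (indicator {-pi..pi} t * cos (t * of_int (int j - k)))) \<partial>lborel)"
    unfolding eq sum_distrib_left by (simp only: mult.left_commute)
  also have "\<dots> = (\<Sum>j\<le>degree Q. coeff P j * (if int j - k = 0 then 2 * pi else 0))"
    by (subst Bochner_Integration.integral_sum)
       (intro integrable_mult_right int, simp only: integral_mult_right_zero integral_cos_int_period)
  also have "\<dots> = (\<Sum>j\<le>degree Q. if int j = k then 2 * pi * coeff P j else 0)"
    by (intro sum.cong) auto
  \<comment> \<open>For negative \<open>k\<close> no summation index matches, in agreement with the
    value 0 of \<open>ext_binom\<close> there.\<close>
  also have "\<dots> = 2 * pi * ext_binom q n k"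
  proof (cases "k < 0")
    case False
    then have "(\<Sum>j\<le>degree Q. if int j = k then 2 * pi * coeff P j else 0) =
                 (\<Sum>j\<le>degree Q. if nat k = j then 2 * pi * coeff P j else 0)"
      by (intro sum.cong) auto
    with False deg[of "nat k"] show ?thesis
      by (auto simp: ext_binom_def P_def sum.delta)
  qed (auto simp: ext_binom_def intro!: sum.neutral)
  finally show ?thesis by (simp add: y_def divide_simps mult.commute)
qed

section \<open>Decay of the characteristic function away from 0\<close>

lemma continuous_on_unif_char [continuous_intros]: "continuous_on A (unif_char q)"
  unfolding unif_char_def by (intro continuous_intros) auto

text \<open>Two neighbouring summands differ by the factor \<open>cis t\<close>, which is not 1, so
  their sum has norm below 2. The triangle inequality for the other \<open>q - 1\<close> unit
  vectors then gives strictness.\<close>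

lemma abs_unif_char_less_1:
  assumes "q \<ge> 1" "\<bar>t\<bar> \<le> pi" "t \<noteq> 0"
  shows "\<bar>unif_char q t\<bar> < 1"
proof -
  define c where "c = (\<lambda>j. cis (t * (real j - real q / 2)))"
  have "cos t \<noteq> 1"
    using assms cos_monotone_0_pi[of 0 "\<bar>t\<bar>"] by auto
  then have cos: "cos t < 1" using cos_le_one[of t] by linarith
  have "c 1 = cis t * c 0" by (simp add: c_def cis_mult algebra_simps)
  then have "c 0 + c 1 = c 0 * (1 + cis t)" by (simp add: algebra_simps)
  then have "norm (c 0 + c 1) = cmod (1 + cis t)"
    by (simp add: norm_mult c_def)
  moreover have "(cmod (1 + cis t))\<^sup>2 = 2 + 2 * cos t"
    using sin_cos_squared_add[of t] unfolding cmod_power2 by (simp add: power2_eq_square algebra_simps)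
  then have "(cmod (1 + cis t))\<^sup>2 < 2\<^sup>2" using cos by simp
  then have "cmod (1 + cis t) < 2" by (rule power2_less_imp_less) simp
  ultimately have first: "norm (c 0 + c 1) < 2" by simp
  have "{..q} = {0, 1} \<union> {2..q}" using assms by auto
  then have "(\<Sum>j\<le>q. c j) = c 0 + c 1 + (\<Sum>j\<in>{2..q}. c j)"
    by (simp only:) (subst sum.union_disjoint, auto)
  then have "norm (\<Sum>j\<le>q. c j) \<le> norm (c 0 + c 1) + norm (\<Sum>j\<in>{2..q}. c j)"
    by (simp add: norm_triangle_ineq)
  also have "norm (\<Sum>j\<in>{2..q}. c j) \<le> (\<Sum>j\<in>{2..q}. norm (c j))" by (rule norm_sum)
  also have "(\<Sum>j\<in>{2..q}. norm (c j)) = real q - 1" using assms by (simp add: c_def)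
  finally have "norm (\<Sum>j\<le>q. c j) < 1 + real q" using first by linarith
  then have "(1 + real q) * \<bar>unif_char q t\<bar> < (1 + real q) * 1"
    unfolding c_def sum_cis_eq_unif_char norm_of_real abs_mult by simp
  then show ?thesis by (subst (asm) mult_less_cancel_left_pos) auto
qed

lemma unif_char_bounded_away_from_0:
  assumes "q \<ge> 1" "0 < \<delta>"
  obtains \<rho> where "0 < \<rho>" "\<rho> < 1" "\<And>t. \<delta> \<le> \<bar>t\<bar> \<Longrightarrow> \<bar>t\<bar> \<le> pi \<Longrightarrow> \<bar>unif_char q t\<bar> \<le> \<rho>"
proof (cases "\<delta> \<le> pi")
  case True
  define K where "K = {-pi..-\<delta>} \<union> {\<delta>..pi}"
  have "compact K" "K \<noteq> {}" using True by (auto simp: K_def)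
  moreover have "continuous_on K (\<lambda>t. \<bar>unif_char q t\<bar>)" by (intro continuous_intros)
  ultimately obtain t0 where t0: "t0 \<in> K" "\<And>t. t \<in> K \<Longrightarrow> \<bar>unif_char q t\<bar> \<le> \<bar>unif_char q t0\<bar>"
    using continuous_attains_sup[of K "\<lambda>t. \<bar>unif_char q t\<bar>"] by blast
  have "\<bar>unif_char q t0\<bar> < 1"
    using t0(1) assms by (intro abs_unif_char_less_1) (auto simp: K_def)
  moreover have "t \<in> K" if "\<delta> \<le> \<bar>t\<bar>" "\<bar>t\<bar> \<le> pi" for t
    using that by (auto simp: K_def)
  \<comment> \<open>The maximum over the compact set might be 0; taking \<open>max (1/2)\<close>
    keeps \<open>\<rho>\<close> positive. For \<open>\<delta> > pi\<close> the claim is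
    vacuous.\<close>
  ultimately show ?thesis
    using t0(2) by (intro that[of "max (1/2) \<bar>unif_char q t0\<bar>"]) (auto simp: le_max_iff_disj)
qed (use that[of "1/2"] in auto)

section \<open>Logarithm of the characteristic function\<close>

lemma bernoulli_fps_mult:
  "Abs_fps (\<lambda>j. complex_of_real (bernoulli_num j / fact j)) * (fps_exp 1 - 1) = fps_X"
proof (rule fps_ext)
  fix n
  define B :: "real fps" where "B = fps_X / (fps_exp 1 - 1)"
  \<comment> \<open>The defining quotient is exact because the divisor has the same subdegree as
    \<open>fps_X\<close>.\<close>
  have "subdegree (fps_exp 1 - 1 :: real fps) = 1"
    by (rule subdegreeI) auto
  then have "fps_exp 1 - 1 dvd (fps_X :: real fps)"
    by (subst fps_dvd_iff) auto
  then have B: "B * (fps_exp 1 - 1) = fps_X"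
    unfolding B_def by (rule dvd_div_mult_self)
  have coeff: "fps_nth (fps_exp 1 - 1) j = complex_of_real (fps_nth (fps_exp 1 - 1) j)" for j
    by (simp add: if_distrib[of of_real])
  have "fps_nth (Abs_fps (\<lambda>j. complex_of_real (bernoulli_num j / fact j)) * (fps_exp 1 - 1)) n =
          of_real (fps_nth (B * (fps_exp 1 - 1)) n)"
    unfolding fps_mult_nth of_real_sum of_real_mult coeff
    by (simp add: bernoulli_num_def B_def)
  then show "fps_nth (Abs_fps (\<lambda>j. complex_of_real (bernoulli_num j / fact j)) * (fps_exp 1 - 1)) n =
          fps_nth fps_X n"
    by (simp add: B)
qed

lemma bernoulli_num_2: "bernoulli_num 2 = 1 / 6"
proof -
  define b where "b = (\<lambda>j. complex_of_real (bernoulli_num j / fact j))"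
  have rec: "(\<Sum>i=0..n. b i * (if n - i = 0 then 0 else 1 / fact (n - i))) = (if n = 1 then 1 else 0)" for n
    using arg_cong[OF bernoulli_fps_mult, of "\<lambda>F. fps_nth F n"]
    by (simp add: fps_mult_nth b_def if_distrib[of "\<lambda>x. _ - x"] cong: if_cong)
  have "b 0 = 1" using rec[of 1] by simp
  moreover from this have "2 * b 1 + 1 = 0" using rec[of 2] by (simp add: eval_nat_numeral field_simps)
  moreover from \<open>b 0 = 1\<close> have "1 + (3 * b 1 + 6 * b 2) = 0"
    using rec[of 3] by (simp add: eval_nat_numeral field_simps)
  ultimately have "12 * b 2 = 1" by algebra
  then have "b 2 = 1 / 12" by (simp add: field_simps)
  then have "complex_of_real (bernoulli_num 2) = of_real (1 / 6)"
    by (simp add: b_def field_simps)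
  then show ?thesis by (simp only: of_real_eq_iff)
qed

text \<open>Moment generating function of the centred uniform distribution on \<open>{0..q}\<close>:
  an entire, even function that equals \<open>unif_char\<close> on the imaginary axis.\<close>

definition unif_mgf :: "nat \<Rightarrow> complex \<Rightarrow> complex" where
  "unif_mgf q z = (\<Sum>j\<le>q. exp ((of_nat j - of_nat q / 2) * z)) / (1 + of_nat q)"

lemma unif_mgf_imaginary: "unif_mgf q (\<i> * of_real t) = of_real (unif_char q t)"
proof -
  have "(\<Sum>j\<le>q. exp ((of_nat j - of_nat q / 2) * (\<i> * of_real t))) =
          (\<Sum>j\<le>q. cis (t * (real j - real q / 2)))"
    by (intro sum.cong) (simp_all add: cis_conv_exp mult_ac)
  moreover have "1 + complex_of_nat q \<noteq> 0"
    by (metis of_nat_Suc of_nat_neq_0)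
  ultimately show ?thesis
    by (simp add: unif_mgf_def sum_cis_eq_unif_char)
qed

lemma unif_mgf_minus: "unif_mgf q (- z) = unif_mgf q z"
proof -
  have "(\<Sum>j\<le>q. exp ((of_nat j - of_nat q / 2) * (- z))) =
          (\<Sum>j\<le>q. exp ((of_nat j - of_nat q / 2) * z))"
    by (rule sum.reindex_bij_witness[of _ "\<lambda>j. q - j" "\<lambda>j. q - j"])
       (auto simp: of_nat_diff field_simps)
  then show ?thesis by (simp add: unif_mgf_def)
qed

lemma unif_mgf_0: "unif_mgf q 0 = 1"
proof -
  have "1 + complex_of_nat q \<noteq> 0"
    by (metis of_nat_Suc of_nat_neq_0)
  then show ?thesis by (simp add: unif_mgf_def add.commute)
qed

text \<open>Summing the geometric series gives
  \<open>F * (exp X - 1) = G * (exp (c * X) - 1)\<close> with \<open>c = 1 + q\<close> and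
  \<open>G\<close> a constant times \<open>exp (- q * X / 2)\<close>. Its logarithmic derivative,
  times \<open>X\<close>, reads \<open>X * L' = q / 2 * X + B (c * X) - B X\<close> with
  \<open>B\<close> the Bernoulli generating function. Taking \<open>j \<ge> 2\<close> removes the
  linear term.\<close>

lemma unif_mgf_log_fps:
  assumes F: "unif_mgf q has_fps_expansion F" and L: "F = fps_exp 1 oo L" "fps_nth L 0 = 0"
    and j: "j \<ge> 2"
  shows "of_nat j * fps_nth L j = of_real (bernoulli_num j / fact j * ((1 + real q) ^ j - 1))"
proof -
  define c :: complex where "c = 1 + of_nat q"
  define E1 E2 G B B2 :: "complex fps" where
    "E1 = fps_exp 1 - 1" and "E2 = fps_exp c - 1"
    and "G = fps_const (1 / c) * fps_exp (- of_nat q / 2)"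
    and "B = Abs_fps (\<lambda>j. of_real (bernoulli_num j / fact j))"
    and "B2 = Abs_fps (\<lambda>j. c ^ j * fps_nth B j)"
  have c0: "c \<noteq> 0" unfolding c_def by (metis of_nat_Suc of_nat_neq_0)
  have F_eq: "F = fps_const (1 / c) * (\<Sum>j\<le>q. fps_exp (of_nat j - of_nat q / 2))"
  proof (rule fps_expansion_unique_complex[OF F])
    have "(\<lambda>z. 1 / c * (\<Sum>j\<le>q. exp ((of_nat j - of_nat q / 2) * z)))
            has_fps_expansion fps_const (1 / c) * (\<Sum>j\<le>q. fps_exp (of_nat j - of_nat q / 2))"
      by (intro fps_expansion_intros)
    then show "unif_mgf q has_fps_expansion fps_const (1 / c) * (\<Sum>j\<le>q. fps_exp (of_nat j - of_nat q / 2))"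
      by (simp add: unif_mgf_def[abs_def] c_def)
  qed
  have BE1: "B * E1 = fps_X" unfolding B_def E1_def by (rule bernoulli_fps_mult)
  have BE2: "B2 * E2 = fps_const c * fps_X"
  proof (rule fps_ext)
    fix n
    have E2: "fps_nth E2 n = c ^ n * fps_nth E1 n" for n
      by (simp add: E1_def E2_def)
    have "fps_nth (B2 * E2) n = c ^ n * fps_nth (B * E1) n"
      unfolding fps_mult_nth sum_distrib_left
      by (intro sum.cong) (auto simp: B2_def E2 simp flip: power_add)
    then show "fps_nth (B2 * E2) n = fps_nth (fps_const c * fps_X) n"
      by (auto simp: BE1 fps_X_def)
  qed
  have FE: "F * E1 = G * E2"
  proof -
    have "(\<Sum>j\<le>q. fps_exp (of_nat j - of_nat q / 2)) * E1 =
            - (\<Sum>j\<le>q. fps_exp (of_nat j - of_nat q / 2) - fps_exp (of_nat (Suc j) - of_nat q / 2) :: complex fps)"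
    proof -
      have "fps_exp (of_nat (Suc j) - of_nat q / 2) = fps_exp (of_nat j - of_nat q / 2) * fps_exp (1::complex)" for j
        by (simp add: algebra_simps flip: fps_exp_add_mult)
      then show ?thesis by (simp add: E1_def sum_distrib_left algebra_simps sum_subtractf)
    qed
    also have "\<dots> = fps_exp (of_nat (Suc q) - of_nat q / 2) - fps_exp (- of_nat q / 2)"
      by (subst sum_telescope) simp
    also have "fps_exp (of_nat (Suc q) - of_nat q / 2) = fps_exp (- of_nat q / 2) * fps_exp c"
      by (simp add: c_def algebra_simps flip: fps_exp_add_mult)
    finally show ?thesis
      unfolding F_eq G_def E2_def mult.assoc by (simp only:) (simp add: algebra_simps)
  qed
  \<comment> \<open>Naming the constant series leaves a pure ring identity for
    \<open>algebra\<close>. Division is avoided by keeping the factor \<open>F * E1\<close>, which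
    is cancelled afterwards.\<close>
  define Q H :: "complex fps" where "Q = fps_const c" and "H = fps_const (of_nat q / 2)"
  have QH: "Q = 2 * H + 1"
    unfolding Q_def H_def c_def by (simp add: fps_const_mult_left numeral_fps_const fps_ext flip: fps_const_1_eq_1)
  have E1': "fps_deriv E1 = E1 + 1" by (simp add: E1_def)
  have E2': "fps_deriv E2 = Q * (E2 + 1)" by (simp add: E2_def Q_def)
  have G': "fps_deriv G = - H * G"
    by (simp add: G_def H_def fps_const_neg[symmetric] mult.left_commute del: fps_const_neg)
  have F': "fps_deriv F = F * fps_deriv L"
    unfolding L(1) by (subst fps_compose_deriv) (simp_all add: L(2))
  have "fps_deriv F * E1 + F * (E1 + 1) = - H * G * E2 + G * (Q * (E2 + 1))"
    using arg_cong[OF FE, of fps_deriv] by (simp add: E1' E2' G' algebra_simps)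
  then have "(F * E1) * (fps_X * fps_deriv L) = (F * E1) * (H * fps_X + B2 - B)"
    using FE BE1 BE2 QH F' unfolding Q_def[symmetric] by algebra
  moreover have "E1 \<noteq> 0"
    using BE1 by auto
  moreover have "F \<noteq> 0" 
  proof -
    have "fps_nth F 0 = 1" by (simp add: L)
    then show ?thesis by auto
  qed
  ultimately have "fps_X * fps_deriv L = H * fps_X + B2 - B"
    by simp
  then have "fps_nth (fps_X * fps_deriv L) j = fps_nth (H * fps_X + B2 - B) j"
    by simp
  moreover have "fps_nth (fps_X * fps_deriv L) j = of_nat j * fps_nth L j"
    using j by (cases j) auto
  moreover have "fps_nth (H * fps_X + B2 - B) j = c ^ j * fps_nth B j - fps_nth B j"
    using j by (simp add: H_def B2_def)
  ultimately show ?thesis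
    by (simp add: B_def c_def algebra_simps)
qed

text \<open>The coefficient of \<open>t ^ (2 * m + 2)\<close> in \<open>ln (unif_char q t)\<close>.\<close>
definition log_char_coeff :: "nat \<Rightarrow> nat \<Rightarrow> real" where
  "log_char_coeff q m =
     (-1) ^ Suc m * bernoulli_num (2 * m + 2) * ((1 + real q) ^ (2 * m + 2) - 1)
       / (fact (2 * m + 2) * real (2 * m + 2))"

text \<open>This is minus half the variance \<open>q * (q + 2) / 12\<close>, so the leading term of
  the logarithm produces the Gaussian.\<close>

lemma log_char_coeff_0: "log_char_coeff q 0 = - (real q * (real q + 2)) / 24"
  by (simp add: log_char_coeff_def bernoulli_num_2[unfolded numeral_2_eq_2] power2_eq_square field_simps)

text \<open>The logarithm of \<open>unif_mgf\<close> is even, hence a power series in the square of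
  its argument. At \<open>\<i> * t\<close> that square is \<open>- t\<^sup>2\<close>, the source of
  the alternating signs. Splitting off one factor \<open>t\<^sup>2\<close> and the constant
  coefficient leaves \<open>\<psi>\<close>.\<close>

lemma unif_char_local_expansion:
  obtains R \<psi> where "R > 0" "\<psi> holomorphic_on ball 0 R"
    "\<psi> has_fps_expansion Abs_fps (\<lambda>m. if m = 0 then 0 else of_real (log_char_coeff q m))"
    "\<And>t. t\<^sup>2 < R \<Longrightarrow> complex_of_real (unif_char q t) =
       exp (of_real (t\<^sup>2) * (of_real (log_char_coeff q 0) + \<psi> (of_real (t\<^sup>2))))"
proof -
  have hol: "unif_mgf q holomorphic_on UNIV"
    unfolding unif_mgf_def
    by (intro holomorphic_intros) (metis of_nat_Suc of_nat_neq_0)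
  then have cont: "continuous_on UNIV (unif_mgf q)"
    by (rule holomorphic_on_imp_continuous_on)
  \<comment> \<open>A disc on which the real part is positive keeps the values off the branch cut of
    \<open>Ln\<close>.\<close>
  then have "open ((\<lambda>z. Re (unif_mgf q z)) -` {0<..})"
    by (intro open_vimage continuous_intros) auto
  moreover have "0 \<in> (\<lambda>z. Re (unif_mgf q z)) -` {0<..}"
    by (simp add: unif_mgf_0)
  ultimately obtain r where r: "r > 0" "ball 0 r \<subseteq> (\<lambda>z. Re (unif_mgf q z)) -` {0<..}"
    using open_contains_ball by blast
  then have Re_pos: "Re (unif_mgf q z) > 0" if "z \<in> ball 0 r" for z
    using that by auto
  define f where "f = (\<lambda>z. Ln (unif_mgf q z))"
  have f_hol: "f holomorphic_on ball 0 r"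
    unfolding f_def
    by (intro holomorphic_on_Ln' holomorphic_on_subset[OF hol])
       (use Re_pos in \<open>force simp: complex_nonpos_Reals_iff\<close>)+
  have f_0: "f 0 = 0" by (simp add: f_def unif_mgf_0)
  define L where "L = fps_expansion f 0"
  have L: "f has_fps_expansion L"
    unfolding L_def by (rule has_fps_expansion_fps_expansion[OF _ _ f_hol]) (use r in auto)
  have L_nth: "fps_nth L n = (deriv ^^ n) f 0 / fact n" for n
    by (rule fps_nth_fps_expansion[OF L])
  have L_0: "fps_nth L 0 = 0" by (simp add: L_nth f_0)
  have exp_f: "exp (f z) = unif_mgf q z" if "z \<in> ball 0 r" for z
    using Re_pos[OF that] unfolding f_def by (intro exp_Ln) auto
  have F: "unif_mgf q has_fps_expansion (fps_exp 1 oo L)"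
  proof -
    have "(exp \<circ> f) has_fps_expansion (fps_exp 1 oo L)"
      by (intro has_fps_expansion_compose has_fps_expansion_exp1 L L_0)
    also have "?this \<longleftrightarrow> ?thesis"
    proof (intro has_fps_expansion_cong refl)
      have "eventually (\<lambda>z. z \<in> ball 0 r) (nhds 0)"
        using r by (intro eventually_nhds_in_open) auto
      then show "\<forall>\<^sub>F z in nhds 0. (exp \<circ> f) z = unif_mgf q z"
        by eventually_elim (simp add: exp_f)
    qed
    finally show ?thesis .
  qed
  have L_odd: "fps_nth L n = 0" if "odd n" for n
  proof -
    have "(deriv ^^ n) (\<lambda>w. f (-1 * w)) 0 = (-1) ^ n * (deriv ^^ n) f (-1 * 0)"
      by (rule higher_deriv_compose_linear[OF f_hol, of "ball 0 r"]) (use r in auto)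
    then show ?thesis using that by (simp add: f_def unif_mgf_minus L_nth)
  qed
  have L_even: "(-1) ^ Suc m * fps_nth L (2 * m + 2) = of_real (log_char_coeff q m)" for m
  proof -
    have "of_nat (2 * m + 2) * fps_nth L (2 * m + 2) =
            of_real (bernoulli_num (2 * m + 2) / fact (2 * m + 2) * ((1 + real q) ^ (2 * m + 2) - 1))"
      by (rule unif_mgf_log_fps[OF F refl L_0]) simp
    moreover have "complex_of_nat (2 * m + 2) \<noteq> 0"
      by (simp only: of_nat_eq_0_iff)
    ultimately have "fps_nth L (2 * m + 2) =
       of_real (bernoulli_num (2 * m + 2) / fact (2 * m + 2) * ((1 + real q) ^ (2 * m + 2) - 1))
         / of_real (real (2 * m + 2))"
      unfolding of_real_of_nat_eq by (metis nonzero_mult_div_cancel_left)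
    then show ?thesis
      by (simp only: log_char_coeff_def flip: of_real_divide) simp
  qed
  \<comment> \<open>\<open>K\<close> is the logarithm along the imaginary axis as a series in
    \<open>w = t\<^sup>2\<close>.\<close>
  define K where "K = Abs_fps (\<lambda>m. (-1) ^ m * fps_nth L (2 * m))"
  define \<Psi> where "\<Psi> = Abs_fps (\<lambda>m. if m = 0 then 0 else complex_of_real (log_char_coeff q m))"
  have K_sums: "(\<lambda>m. fps_nth K m * of_real (t\<^sup>2) ^ m) sums f (\<i> * of_real t)" if "\<bar>t\<bar> < r" for t
  proof -
    have "(\<lambda>n. (deriv ^^ n) f 0 / fact n * (\<i> * of_real t - 0) ^ n) sums f (\<i> * of_real t)"
      by (rule holomorphic_power_series[OF f_hol]) (use that in \<open>auto simp: norm_mult\<close>)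
    then have "(\<lambda>n. fps_nth L n * (\<i> * of_real t) ^ n) sums f (\<i> * of_real t)"
      by (simp add: L_nth)
    then have "(\<lambda>m. fps_nth L (2 * m) * (\<i> * of_real t) ^ (2 * m)) sums f (\<i> * of_real t)"
    proof (subst sums_mono_reindex[of "\<lambda>m. 2 * m"])
      fix n assume "n \<notin> range (\<lambda>m::nat. 2 * m)"
      then have "odd n" by (auto elim: evenE)
      then show "fps_nth L n * (\<i> * of_real t) ^ n = 0" by (simp add: L_odd)
    qed (auto simp: strict_mono_def)
    moreover have "(\<i> * of_real t) ^ (2 * m) = (-1) ^ m * of_real (t\<^sup>2) ^ m" for m
      by (simp add: power_mult power_mult_distrib power_minus[of "(of_real t)\<^sup>2"])
    ultimately show ?thesis
      by (simp add: K_def mult_ac)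
  qed
  \<comment> \<open>Convergence at the single point \<open>(r / 2)\<^sup>2\<close> already bounds
    the radius from below; halving \<open>r\<close> keeps \<open>t\<close> strictly inside the
    disc.\<close>
  have K_radius: "fps_conv_radius K \<ge> ereal ((r / 2)\<^sup>2)"
  proof -
    have "summable (\<lambda>m. fps_nth K m * of_real ((r / 2)\<^sup>2) ^ m)"
      using K_sums[of "r / 2"] r by (auto simp: sums_iff)
    from conv_radius_geI[OF this] show ?thesis
      using r by (simp add: fps_conv_radius_def norm_power)
  qed
  have K_eq: "K = fps_X * (fps_const (of_real (log_char_coeff q 0)) + \<Psi>)"
  proof (rule fps_ext)
    fix n show "fps_nth K n = fps_nth (fps_X * (fps_const (of_real (log_char_coeff q 0)) + \<Psi>)) n"
      using L_even[of "n - 1"] L_0 by (cases n) (auto simp: K_def \<Psi>_def)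
  qed
  have "\<Psi> = fps_shift 1 K - fps_const (of_real (log_char_coeff q 0))"
    unfolding K_eq by (intro fps_ext) simp
  then have \<Psi>_radius: "fps_conv_radius \<Psi> \<ge> ereal ((r / 2)\<^sup>2)"
    using K_radius by (simp add: fps_conv_radius_diff_ge)
  show ?thesis
  proof (rule that[of "(r / 2)\<^sup>2" "eval_fps \<Psi>"])
    show "(r / 2)\<^sup>2 > 0" using r by simp
    show "eval_fps \<Psi> holomorphic_on ball 0 ((r / 2)\<^sup>2)"
    proof (rule holomorphic_on_eval_fps)
      show "ball 0 ((r / 2)\<^sup>2) \<subseteq> eball 0 (fps_conv_radius \<Psi>)"
        using ball_eball_mono[OF \<Psi>_radius] .
    qed
    have "0 < ereal ((r / 2)\<^sup>2)" using r by simp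
    then have "fps_conv_radius \<Psi> > 0" using \<Psi>_radius by (rule less_le_trans)
    then show "eval_fps \<Psi> has_fps_expansion Abs_fps (\<lambda>m. if m = 0 then 0 else of_real (log_char_coeff q m))"
      unfolding \<Psi>_def by (rule eval_fps_has_fps_expansion)
  next
    fix t :: real assume t: "t\<^sup>2 < (r / 2)\<^sup>2"
    then have "\<bar>t\<bar> < \<bar>r / 2\<bar>" by (metis abs_ge_zero power2_abs power2_less_imp_less)
    then have t': "\<bar>t\<bar> < r" using r by simp
    define w where "w = complex_of_real (t\<^sup>2)"
    have "ereal (norm w) < ereal ((r / 2)\<^sup>2)" unfolding w_def norm_of_real using t by simp
    then have w: "ereal (norm w) < fps_conv_radius \<Psi>" using \<Psi>_radius by (rule less_le_trans)
    have "f (\<i> * of_real t) = eval_fps K w"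
      using K_sums[OF t'] by (simp add: eval_fps_def sums_iff w_def)
    also have "\<dots> = w * (of_real (log_char_coeff q 0) + eval_fps \<Psi> w)"
    proof -
      have "ereal (norm w) < fps_conv_radius (fps_const (of_real (log_char_coeff q 0)) + \<Psi>)"
        using w fps_conv_radius_add[of "fps_const (of_real (log_char_coeff q 0))" \<Psi>]
        by (auto simp: min_def)
      then show ?thesis unfolding K_eq
        using w by (subst eval_fps_mult) (auto simp: eval_fps_add)
    qed
    finally have "exp (w * (of_real (log_char_coeff q 0) + eval_fps \<Psi> w)) = unif_mgf q (\<i> * of_real t)"
      using exp_f[of "\<i> * of_real t"] t' by (simp add: norm_mult)
    then show "complex_of_real (unif_char q t) =
       exp (of_real (t\<^sup>2) * (of_real (log_char_coeff q 0) + eval_fps \<Psi> (of_real (t\<^sup>2))))"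
      by (simp add: w_def unif_mgf_imaginary)
  qed
qed

section \<open>Approximation of powers of the characteristic function\<close>

text \<open>Used with \<open>w = t\<^sup>2\<close> and \<open>v = n * t\<^sup>2\<close>: both bounds lose only \<open>exp (v * \<eta>)\<close>, which for
  small \<open>\<eta>\<close> the Gaussian factor absorbs.\<close>
lemma exp_scaled_Taylor_bounds:
  fixes \<psi> :: "complex \<Rightarrow> complex"
  assumes hol: "\<psi> holomorphic_on ball 0 R" and \<Psi>: "\<psi> has_fps_expansion \<Psi>" "fps_nth \<Psi> 0 = 0"
    and r: "0 < r" "r < R" and bound: "\<And>w. norm w \<le> r \<Longrightarrow> norm (\<psi> w) \<le> \<eta>" and v: "v \<ge> 0"
  defines "g \<equiv> exp_coeff (\<lambda>m. of_real v * fps_nth \<Psi> m)"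
  shows "norm (g \<nu>) \<le> exp (v * \<eta>) / r ^ \<nu>"
    and "norm w \<le> r / 2 \<Longrightarrow> norm (exp (of_real v * \<psi> w) - (\<Sum>\<nu>\<le>M. g \<nu> * w ^ \<nu>))
           \<le> 2 * exp (v * \<eta>) * (norm w / r) ^ Suc M"
proof -
  define f where "f = (\<lambda>w. exp (of_real v * \<psi> w))"
  have f_hol: "f holomorphic_on ball 0 R"
    unfolding f_def by (intro holomorphic_intros hol)
  have "((\<lambda>z. exp (of_real v * z)) \<circ> \<psi>) has_fps_expansion (fps_exp (of_real v) oo \<Psi>)"
    by (intro has_fps_expansion_compose has_fps_expansion_exp \<Psi>)
  then have "f has_fps_expansion (fps_exp (of_real v) oo \<Psi>)"
    by (simp add: f_def o_def)
  then have g: "g n = (deriv ^^ n) f 0 / fact n" for n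
    unfolding g_def by (subst fps_exp_compose_nth[symmetric]) (auto simp: \<Psi> fps_nth_fps_expansion)
  have g_bound: "norm (g n) \<le> exp (v * \<eta>) / r ^ n" for n
  proof -
    have "norm ((deriv ^^ n) f 0) \<le> fact n * exp (v * \<eta>) / r ^ n"
    proof (rule Cauchy_inequality)
      show "f holomorphic_on ball 0 r"
        using r by (intro holomorphic_on_subset[OF f_hol]) auto
      have "f holomorphic_on cball 0 r"
        using r by (intro holomorphic_on_subset[OF f_hol]) auto
      then show "continuous_on (cball 0 r) f" by (rule holomorphic_on_imp_continuous_on)
      fix x :: complex assume x: "norm (0 - x) = r"
      \<comment> \<open>Only the real part of the exponent matters, and \<open>v \<ge> 0\<close>
        preserves its bound by \<open>\<eta>\<close>.\<close>
      have "norm (f x) = exp (v * Re (\<psi> x))" by (simp add: f_def)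
      also have "v * Re (\<psi> x) \<le> v * \<eta>"
        using v x bound[of x] complex_Re_le_cmod[of "\<psi> x"] by (intro mult_left_mono) auto
      finally show "norm (f x) \<le> exp (v * \<eta>)" by simp
    qed (use r in auto)
    then show ?thesis by (simp add: g norm_divide field_simps)
  qed
  then show "norm (g \<nu>) \<le> exp (v * \<eta>) / r ^ \<nu>" .
  assume w: "norm w \<le> r / 2"
  define x where "x = norm w / r"
  \<comment> \<open>With ratio at most 1/2 the geometric tail is at most twice its first term, hence
    the factor 2 in the bound.\<close>
  have x: "0 \<le> x" "x \<le> 1 / 2" using w r by (auto simp: x_def field_simps)
  have "(\<lambda>n. g n * w ^ n) sums f w"
    using holomorphic_power_series[OF f_hol, of w] w r by (simp add: g)
  then have "(\<lambda>n. g (n + Suc M) * w ^ (n + Suc M)) sums (f w - (\<Sum>i<Suc M. g i * w ^ i))"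
    by (rule sums_split_initial_segment)
  moreover have "(\<lambda>n. exp (v * \<eta>) * x ^ Suc M * x ^ n) sums (exp (v * \<eta>) * x ^ Suc M * (1 / (1 - x)))"
    using x by (intro sums_mult geometric_sums) auto
  moreover have "norm (g (n + Suc M) * w ^ (n + Suc M)) \<le> exp (v * \<eta>) * x ^ Suc M * x ^ n" for n
  proof -
    have "norm (g (n + Suc M) * w ^ (n + Suc M)) \<le> exp (v * \<eta>) / r ^ (n + Suc M) * norm w ^ (n + Suc M)"
      unfolding norm_mult norm_power by (intro mult_right_mono g_bound) auto
    also have "\<dots> = exp (v * \<eta>) * x ^ (n + Suc M)"
      by (simp add: x_def power_divide)
    finally show ?thesis by (simp add: power_add mult_ac)
  qed
  ultimately have "norm (f w - (\<Sum>i<Suc M. g i * w ^ i)) \<le> exp (v * \<eta>) * x ^ Suc M * (1 / (1 - x))"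
    by (rule norm_sums_le)
  also have "\<dots> \<le> exp (v * \<eta>) * x ^ Suc M * 2"
    using x by (intro mult_left_mono) (auto simp: field_simps)
  finally show "norm (exp (of_real v * \<psi> w) - (\<Sum>\<nu>\<le>M. g \<nu> * w ^ \<nu>))
           \<le> 2 * exp (v * \<eta>) * (norm w / r) ^ Suc M"
    by (simp add: f_def x_def lessThan_Suc_atMost mult_ac)
qed

lemma exp_coeff_cong:
  "(\<And>m. m \<ge> 1 \<Longrightarrow> a m = b m) \<Longrightarrow> exp_coeff a \<nu> = exp_coeff b \<nu>"
  unfolding exp_coeff_def by (intro sum.cong prod.cong) auto

lemma exp_coeff_of_real:
  "exp_coeff (\<lambda>m. of_real (a m)) \<nu> = complex_of_real (exp_coeff a \<nu>)"
  by (simp add: exp_coeff_def)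

text \<open>The line is split at \<open>t\<^sup>2 = r / 2\<close>. Inside, the Taylor remainder is
  estimated. Outside, the power of \<open>unif_char\<close> is at most \<open>\<rho> ^ n\<close> on
  the period, and the Gaussian terms are bounded separately.\<close>

lemma unif_char_power_expansion:
  fixes q M :: nat
  assumes q: "q \<ge> 1"
  defines "s \<equiv> real q * (real q + 2) / 12"
  obtains C \<rho> where "0 \<le> C" "0 < \<rho>" "\<rho> < 1"
    "\<And>n t. \<bar>indicator {-pi..pi} t * unif_char q t ^ n - exp (- (s * (real n * t\<^sup>2) / 2)) *
               (\<Sum>\<nu>\<le>M. exp_coeff (\<lambda>m. real n * t\<^sup>2 * log_char_coeff q m) \<nu> * t ^ (2 * \<nu>))\<bar>
           \<le> C * (exp (- (s * (real n * t\<^sup>2) / 4)) * t ^ (2 * M + 2)) + indicator {-pi..pi} t * \<rho> ^ n"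
proof -
  have s: "s > 0" "log_char_coeff q 0 = - s / 2"
    using q by (simp_all add: s_def log_char_coeff_0)
  obtain R \<psi> where R: "R > 0" and hol: "\<psi> holomorphic_on ball 0 R"
    and \<psi>: "\<psi> has_fps_expansion Abs_fps (\<lambda>m. if m = 0 then 0 else of_real (log_char_coeff q m))"
    and D: "\<And>t. t\<^sup>2 < R \<Longrightarrow> complex_of_real (unif_char q t) =
       exp (of_real (t\<^sup>2) * (of_real (log_char_coeff q 0) + \<psi> (of_real (t\<^sup>2))))"
    using unif_char_local_expansion[of q] by blast
  have \<psi>0: "\<psi> 0 = 0"
    using fps_nth_fps_expansion[OF \<psi>, of 0] by simp
  have "continuous_on (ball 0 R) \<psi>" using hol by (rule holomorphic_on_imp_continuous_on)
  then have "continuous (at 0) \<psi>" using R by (simp add: continuous_on_eq_continuous_at)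
  moreover have "s / 4 > 0" using s(1) by simp
  ultimately have "\<exists>d>0. \<forall>w. dist w 0 < d \<longrightarrow> dist (\<psi> w) (\<psi> 0) < s / 4"
    unfolding continuous_at_eps_delta by blast
  then obtain r0 where r0: "r0 > 0" "\<And>w. norm w < r0 \<Longrightarrow> norm (\<psi> w) < s / 4"
    by (auto simp: \<psi>0)
  \<comment> \<open>The three bounds ensure, in turn, \<open>norm (\<psi> w) < s / 4\<close>,
    holomorphy on a larger disc, and \<open>\<bar>t\<bar> \<le> pi\<close> whenever
    \<open>t\<^sup>2 \<le> r / 2\<close>.\<close>
  define r where "r = min (min (r0 / 2) (R / 2)) (2 * pi\<^sup>2)"
  have r: "0 < r" "r < R" "r < r0" "r \<le> 2 * pi\<^sup>2"
    using r0 R by (auto simp: r_def min_less_iff_disj)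
  have bound: "norm (\<psi> w) \<le> s / 4" if "norm w \<le> r" for w
    using r0(2)[of w] that r by linarith
  define \<delta> where "\<delta> = sqrt (r / 2)"
  have \<delta>: "\<delta> > 0" using r by (simp add: \<delta>_def)
  obtain \<rho> where \<rho>: "0 < \<rho>" "\<rho> < 1" "\<And>t. \<delta> \<le> \<bar>t\<bar> \<Longrightarrow> \<bar>t\<bar> \<le> pi \<Longrightarrow> \<bar>unif_char q t\<bar> \<le> \<rho>"
    using unif_char_bounded_away_from_0[OF q \<delta>] by blast
  \<comment> \<open>With \<open>x = t\<^sup>2 / r\<close> this makes
    \<open>C * t ^ (2 * M + 2)\<close> equal to \<open>(M + 1) * (2 * x) ^ Suc M\<close>, a bound
    that serves both regions.\<close>
  define C where "C = real (M + 1) * 2 ^ Suc M / r ^ Suc M"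
  show ?thesis
  proof (rule that[of C \<rho>])
    show "0 \<le> C" using r by (simp add: C_def)
  next
    fix n :: nat and t :: real
    define v where "v = real n * t\<^sup>2"
    define g where "g = exp_coeff (\<lambda>m. v * log_char_coeff q m)"
    define gc where "gc = exp_coeff (\<lambda>m. of_real v *
        fps_nth (Abs_fps (\<lambda>m. if m = 0 then 0 else complex_of_real (log_char_coeff q m))) m)"
    have v: "v \<ge> 0" by (simp add: v_def)
    \<comment> \<open>The two coefficient sequences differ at index 0, but \<open>exp_coeff\<close>
      reads only indices from 1 on.\<close>
    have gc: "gc \<nu> = of_real (g \<nu>)" for \<nu>
      unfolding gc_def g_def exp_coeff_of_real[symmetric] by (rule exp_coeff_cong) simp
    note Taylor = exp_scaled_Taylor_bounds[OF hol \<psi> _ r(1,2) bound v, folded gc_def, unfolded gc, simplified]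
    define x where "x = t\<^sup>2 / r"
    have x: "x \<ge> 0" using r by (simp add: x_def)
    \<comment> \<open>Half of the Gaussian decay pays for the growth \<open>exp (v * \<eta>)\<close>
      with \<open>\<eta> = s / 4\<close>.\<close>
    have exp_eq: "exp (- (s * v / 2)) * exp (v * (s / 4)) = exp (- (s * v / 4))"
      by (simp flip: exp_add)
    have t_pow: "t ^ (2 * M + 2) = (t\<^sup>2) ^ Suc M"
      unfolding power_mult[symmetric] by simp
    have x_pow: "C * (exp (- (s * v / 4)) * t ^ (2 * M + 2)) =
        exp (- (s * v / 4)) * (real (M + 1) * (2 * x) ^ Suc M)"
      unfolding t_pow C_def x_def power_divide power_mult_distrib by simp
    have "\<bar>indicator {-pi..pi} t * unif_char q t ^ n - exp (- (s * v / 2)) * (\<Sum>\<nu>\<le>M. g \<nu> * t ^ (2 * \<nu>))\<bar>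
           \<le> C * (exp (- (s * v / 4)) * t ^ (2 * M + 2)) + indicator {-pi..pi} t * \<rho> ^ n"
    proof (cases "t\<^sup>2 \<le> r / 2")
      case True
      define w where "w = complex_of_real (t\<^sup>2)"
      have w_pow: "complex_of_real (t ^ (2 * \<nu>)) = w ^ \<nu>" for \<nu>
        by (simp add: w_def power_mult)
      have w: "norm w = t\<^sup>2" by (simp add: w_def norm_power)
      have "t\<^sup>2 \<le> pi\<^sup>2" using True r(4) by simp
      then have "\<bar>t\<bar> \<le> pi" using power2_le_iff_abs_le[of pi t] by simp
      then have ind: "indicator {-pi..pi} t = (1 :: real)" by (auto simp: indicator_def)
      have "complex_of_real (unif_char q t ^ n) = exp (w * (of_real (- s / 2) + \<psi> w)) ^ n"
        using D[of t] True r unfolding of_real_power by (simp add: w_def s)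
      also have "\<dots> = exp (of_real (- (s * v / 2))) * exp (of_real v * \<psi> w)"
        by (simp add: v_def w_def algebra_simps flip: exp_of_nat_mult exp_add)
      finally have "complex_of_real (unif_char q t ^ n - exp (- (s * v / 2)) * (\<Sum>\<nu>\<le>M. g \<nu> * t ^ (2 * \<nu>))) =
              of_real (exp (- (s * v / 2))) * (exp (of_real v * \<psi> w) - (\<Sum>\<nu>\<le>M. of_real (g \<nu>) * w ^ \<nu>))"
        unfolding of_real_diff of_real_mult of_real_sum w_pow by (simp only: exp_of_real right_diff_distrib)
      from arg_cong[OF this, of norm]
      have "\<bar>unif_char q t ^ n - exp (- (s * v / 2)) * (\<Sum>\<nu>\<le>M. g \<nu> * t ^ (2 * \<nu>))\<bar> =
           exp (- (s * v / 2)) * norm (exp (of_real v * \<psi> w) - (\<Sum>\<nu>\<le>M. of_real (g \<nu>) * w ^ \<nu>))"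
        unfolding norm_mult norm_of_real by simp
      also have "\<dots> \<le> exp (- (s * v / 2)) * (2 * exp (v * (s / 4)) * x ^ Suc M)"
        using Taylor(2)[of w M] True w by (intro mult_left_mono) (auto simp: x_def)
      also have "\<dots> = exp (- (s * v / 4)) * (1 * (2 * x ^ Suc M))"
        unfolding exp_eq[symmetric] by simp
      also have "\<dots> \<le> exp (- (s * v / 4)) * (real (M + 1) * (2 * x) ^ Suc M)"
      proof (intro mult_left_mono mult_mono)
        show "2 * x ^ Suc M \<le> (2 * x) ^ Suc M"
          unfolding power_mult_distrib using x by (intro mult_right_mono) auto
      qed (use x in auto)
      finally show ?thesis
        unfolding x_pow ind using zero_le_power[of \<rho> n] \<rho>(1) by linarith
    next
      case False
      then have "\<delta> \<le> \<bar>t\<bar>" unfolding \<delta>_def by (intro real_le_lsqrt) auto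
      then have "\<bar>indicator {-pi..pi} t * unif_char q t ^ n\<bar> \<le> indicator {-pi..pi} t * \<rho> ^ n"
        using \<rho>(3)[of t] by (auto simp: indicator_def power_abs intro!: power_mono)
      moreover have "\<bar>exp (- (s * v / 2)) * (\<Sum>\<nu>\<le>M. g \<nu> * t ^ (2 * \<nu>))\<bar>
                       \<le> C * (exp (- (s * v / 4)) * t ^ (2 * M + 2))"
      proof -
        \<comment> \<open>Away from 0 the highest power of \<open>2 * x\<close> dominates all lower
          ones, so each of the \<open>M + 1\<close> terms has the same bound.\<close>
        have x': "2 * x \<ge> 1" using False r by (simp add: x_def field_simps)
        have "\<bar>\<Sum>\<nu>\<le>M. g \<nu> * t ^ (2 * \<nu>)\<bar> \<le> (\<Sum>\<nu>\<le>M. \<bar>g \<nu> * t ^ (2 * \<nu>)\<bar>)"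
          by (rule sum_abs)
        also have "\<dots> \<le> (\<Sum>\<nu>\<le>M. exp (v * (s / 4)) * (2 * x) ^ Suc M)"
        proof (rule sum_mono)
          fix \<nu> assume \<nu>: "\<nu> \<in> {..M}"
          have "\<bar>g \<nu> * t ^ (2 * \<nu>)\<bar> = \<bar>g \<nu>\<bar> * (t\<^sup>2) ^ \<nu>"
            by (simp add: abs_mult power_mult)
          also have "\<dots> \<le> exp (v * (s / 4)) / r ^ \<nu> * (t\<^sup>2) ^ \<nu>"
            using Taylor(1)[of \<nu>] by (intro mult_right_mono) auto
          also have "\<dots> = exp (v * (s / 4)) * x ^ \<nu>"
            by (simp add: x_def power_divide)
          also have "x ^ \<nu> \<le> (2 * x) ^ \<nu>"
            using x by (intro power_mono) auto
          also have "(2 * x) ^ \<nu> \<le> (2 * x) ^ Suc M"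
            using x' \<nu> by (intro power_increasing) auto
          finally show "\<bar>g \<nu> * t ^ (2 * \<nu>)\<bar> \<le> exp (v * (s / 4)) * (2 * x) ^ Suc M" by simp
        qed
        also have "\<dots> = exp (v * (s / 4)) * (real (M + 1) * (2 * x) ^ Suc M)" by simp
        finally have "exp (- (s * v / 2)) * \<bar>\<Sum>\<nu>\<le>M. g \<nu> * t ^ (2 * \<nu>)\<bar> \<le>
           exp (- (s * v / 2)) * (exp (v * (s / 4)) * (real (M + 1) * (2 * x) ^ Suc M))"
          by (intro mult_left_mono) auto
        then show ?thesis unfolding x_pow unfolding exp_eq[symmetric] by (simp add: abs_mult mult.assoc)
      qed
      ultimately show ?thesis by linarith
    qed
    then show "\<bar>indicator {-pi..pi} t * unif_char q t ^ n - exp (- (s * (real n * t\<^sup>2) / 2)) *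
               (\<Sum>\<nu>\<le>M. exp_coeff (\<lambda>m. real n * t\<^sup>2 * log_char_coeff q m) \<nu> * t ^ (2 * \<nu>))\<bar>
           \<le> C * (exp (- (s * (real n * t\<^sup>2) / 4)) * t ^ (2 * M + 2)) + indicator {-pi..pi} t * \<rho> ^ n"
      by (simp only: g_def v_def)
  qed (use \<rho> in auto)
qed

section \<open>Gaussian Fourier integrals\<close>

text \<open>This second-order bound, uniform in \<open>c\<close>, is what justifies differentiating
  a cosine integral under the integral sign.\<close>

lemma cos_add_Taylor_bound:
  fixes c s :: real
  shows "\<bar>cos (c + s) - cos c + s * sin c\<bar> \<le> s\<^sup>2"
proof -
  have "cmod (iexp c * (iexp s - 1 - \<i> * s)) \<le> s\<^sup>2 / 2"
    using iexp_approx1[of s 1] unfolding norm_mult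
    by (simp add: power2_eq_square diff_diff_eq)
  moreover have "Re (iexp c * (iexp s - 1 - \<i> * s)) = cos (c + s) - cos c + s * sin c"
    by (simp add: cos_add algebra_simps flip: cis_conv_exp)
  ultimately show ?thesis
    using abs_Re_le_cmod[of "iexp c * (iexp s - 1 - \<i> * s)"] by simp
qed

text \<open>The phase \<open>j * pi / 2\<close> absorbs the alternation between sine and cosine:
  differentiating in \<open>x\<close> simply raises \<open>j\<close> by one.\<close>

definition normal_fourier_moment :: "nat \<Rightarrow> real \<Rightarrow> real" where
  "normal_fourier_moment j x =
     (\<integral>u. std_normal_density u * u ^ j * cos (u * x + real j * pi / 2) \<partial>lborel)"

lemma integrable_normal_cos:
  "integrable lborel (\<lambda>u. std_normal_density u * u ^ j * cos (u * x + c))"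
  by (rule Bochner_Integration.integrable_bound[OF integrable_std_normal_moment[of j]])
     (auto intro!: mult_left_le simp: abs_mult)

text \<open>The first-order error of the integrand is quadratic in \<open>h\<close>; integrating it
  costs the absolute moment of order \<open>j + 2\<close>, which is the constant
  \<open>C\<close>.\<close>

lemma normal_fourier_moment_has_real_derivative:
  "(normal_fourier_moment j has_real_derivative normal_fourier_moment (Suc j) x) (at x)"
proof -
  let ?A = normal_fourier_moment
  define C where "C = (\<integral>u. std_normal_density u * \<bar>u\<bar> ^ (j + 2) \<partial>lborel)"
  define F where "F = (\<lambda>j x u. std_normal_density u * u ^ j * cos (u * x + real j * pi / 2))"
  have int [simp]: "integrable lborel (F j x)" for j x
    unfolding F_def by (rule integrable_normal_cos)
  have A_eq: "?A j x = (\<integral>u. F j x u \<partial>lborel)" for j x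
    by (simp only: normal_fourier_moment_def F_def)
  have bound: "\<bar>?A j (x + h) - ?A j x - h * ?A (Suc j) x\<bar> \<le> C * h\<^sup>2" for h
  proof -
    have "?A j (x + h) - ?A j x - h * ?A (Suc j) x =
            (\<integral>u. F j (x + h) u - F j x u - h * F (Suc j) x u \<partial>lborel)"
      by (simp add: A_eq)
    also have "\<bar>\<dots>\<bar> \<le> (\<integral>u. std_normal_density u * \<bar>u\<bar> ^ (j + 2) * h\<^sup>2 \<partial>lborel)"
    proof (rule order_trans[OF integral_abs_bound Bochner_Integration.integral_mono])
      show "integrable lborel (\<lambda>u. std_normal_density u * \<bar>u\<bar> ^ (j + 2) * h\<^sup>2)"
        by (intro integrable_mult_left integrable_std_normal_moment_abs)
      fix u
      define c where "c = u * x + real j * pi / 2"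
      have *: "u * (x + h) + real j * pi / 2 = c + u * h"
        by (simp add: c_def algebra_simps)
      have "u * x + real (Suc j) * pi / 2 = c + pi / 2"
        by (simp add: c_def field_simps)
      then have **: "cos (u * x + real (Suc j) * pi / 2) = - sin c"
        by (simp add: cos_add)
      have "F j (x + h) u - F j x u - h * F (Suc j) x u =
              std_normal_density u * u ^ j * (cos (c + u * h) - cos c + u * h * sin c)"
        unfolding F_def * ** by (simp add: c_def algebra_simps)
      also have "\<bar>\<dots>\<bar> \<le> std_normal_density u * \<bar>u\<bar> ^ j * (u * h)\<^sup>2"
        unfolding abs_mult power_abs
        using cos_add_Taylor_bound[of c "u * h"] by (intro mult_mono) auto
      also have "\<dots> = std_normal_density u * \<bar>u\<bar> ^ (j + 2) * h\<^sup>2"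
        by (simp add: power_mult_distrib power_add power2_eq_square)
      finally show "\<bar>F j (x + h) u - F j x u - h * F (Suc j) x u\<bar>
                      \<le> std_normal_density u * \<bar>u\<bar> ^ (j + 2) * h\<^sup>2" .
    qed (intro integrable_abs Bochner_Integration.integrable_diff integrable_mult_right int)
    also have "\<dots> = C * h\<^sup>2" by (simp add: C_def)
    finally show ?thesis .
  qed
  have "(\<lambda>h. (?A j (x + h) - ?A j x) / h) \<midarrow>0\<rightarrow> ?A (Suc j) x"
  proof (rule Lim_null[THEN iffD2], rule Lim_null_comparison)
    show "\<forall>\<^sub>F h in at 0. norm ((?A j (x + h) - ?A j x) / h - ?A (Suc j) x) \<le> C * \<bar>h\<bar>"
      unfolding eventually_at_filter
    proof (intro always_eventually allI impI)
      fix h :: real assume h: "h \<noteq> 0"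
      then have "(?A j (x + h) - ?A j x) / h - ?A (Suc j) x =
              (?A j (x + h) - ?A j x - h * ?A (Suc j) x) / h"
        by (simp add: field_simps)
      also have "\<bar>\<dots>\<bar> \<le> C * h\<^sup>2 / \<bar>h\<bar>"
        unfolding abs_divide by (intro divide_right_mono bound) auto
      also have "\<dots> = C * \<bar>h\<bar>"
        using h by (simp add: field_simps power2_eq_square)
      finally show "norm ((?A j (x + h) - ?A j x) / h - ?A (Suc j) x) \<le> C * \<bar>h\<bar>"
        by simp
    qed
    show "(\<lambda>h. C * \<bar>h\<bar>) \<midarrow>0\<rightarrow> 0" by real_asymp
  qed
  then show ?thesis by (simp add: DERIV_def)
qed

lemma normal_fourier_moment_0: "normal_fourier_moment 0 x = exp (- (x\<^sup>2) / 2)"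
proof -
  have int: "integrable lborel (\<lambda>u. std_normal_density u *\<^sub>R iexp (x * u))"
    by (rule Bochner_Integration.integrable_bound[OF integrable_std_normal_moment[of 0]])
       (auto simp: abs_mult)
  have "exp (- (x\<^sup>2) / 2) = Re (char std_normal_distribution x)"
    by (simp only: char_std_normal_distribution Re_complex_of_real)
  also have "char std_normal_distribution x = (\<integral>u. std_normal_density u *\<^sub>R iexp (x * u) \<partial>lborel)"
    unfolding char_def by (subst integral_density) auto
  also have "Re \<dots> = (\<integral>u. Re (std_normal_density u *\<^sub>R iexp (x * u)) \<partial>lborel)"
    using int by (rule integral_Re[symmetric])
  also have "\<dots> = normal_fourier_moment 0 x"
    unfolding normal_fourier_moment_def
    by (intro Bochner_Integration.integral_cong) (simp_all add: Re_exp mult.commute)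
  finally show ?thesis by simp
qed

lemma higher_deriv_gaussian:
  "(deriv ^^ j) (\<lambda>t. exp (- (t\<^sup>2) / 2)) = normal_fourier_moment j"
proof (induction j)
  case (Suc j)
  then show ?case
    using DERIV_imp_deriv[OF normal_fourier_moment_has_real_derivative] by auto
qed (auto simp: normal_fourier_moment_0)

text \<open>By Rodrigues' formula the Hermite function is a derivative of the Gaussian, that is, a
  \<open>normal_fourier_moment\<close>; at even order its phase is a multiple of \<open>pi\<close>
  and becomes the sign \<open>(-1) ^ m\<close>.\<close>

lemma hermite_even_fourier:
  "(\<integral>u. exp (- (u\<^sup>2) / 2) * u ^ (2 * m) * cos (u * x) \<partial>lborel) =
     sqrt (2 * pi) * (-1) ^ m * exp (- (x\<^sup>2) / 2) * hermite (2 * m) x"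
proof -
  have cos: "cos (u * x) = (-1) ^ m * cos (u * x + real (2 * m) * pi / 2)" for u
    by (simp add: cos_add)
  have "(\<integral>u. exp (- (u\<^sup>2) / 2) * u ^ (2 * m) * cos (u * x) \<partial>lborel) =
          (\<integral>u. (sqrt (2 * pi) * (-1) ^ m) *
               (std_normal_density u * u ^ (2 * m) * cos (u * x + real (2 * m) * pi / 2)) \<partial>lborel)"
    by (intro Bochner_Integration.integral_cong refl) (subst cos, simp add: std_normal_density_def)
  also have "\<dots> = sqrt (2 * pi) * (-1) ^ m * (deriv ^^ (2 * m)) (\<lambda>t. exp (- (t\<^sup>2) / 2)) x"
    by (simp only: higher_deriv_gaussian normal_fourier_moment_def integral_mult_right_zero)
  also have "(deriv ^^ (2 * m)) (\<lambda>t. exp (- (t\<^sup>2) / 2)) x = exp (- (x\<^sup>2) / 2) * hermite (2 * m) x"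
    by (simp add: hermite_def flip: exp_add mult.assoc)
  finally show ?thesis by simp
qed

lemma hermite_0: "hermite 0 x = 1"
  by (simp add: hermite_def flip: exp_add)

section \<open>Gaussian moments under scaling\<close>

lemma integrable_exp_neg_square_moment:
  "integrable lborel (\<lambda>u. exp (- (u\<^sup>2) / 2) * u ^ j :: real)"
proof -
  have "integrable lborel (\<lambda>u. sqrt (2 * pi) * (std_normal_density u * u ^ j))"
    by (intro integrable_mult_right integrable_std_normal_moment)
  then show ?thesis by (simp add: std_normal_density_def)
qed

lemma integrable_gaussian_moment:
  assumes "a > 0"
  shows "integrable lborel (\<lambda>t. exp (- (a * t\<^sup>2 / 2)) * t ^ j :: real)"
proof -
  have "integrable lborel (\<lambda>t. exp (- ((0 + sqrt a * t)\<^sup>2) / 2) * (0 + sqrt a * t) ^ j)"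
    by (rule lborel_integrable_real_affine[OF integrable_exp_neg_square_moment]) (use assms in auto)
  then have "integrable lborel (\<lambda>t. sqrt a ^ j * (exp (- (a * t\<^sup>2 / 2)) * t ^ j))"
    using assms by (simp add: power_mult_distrib mult_ac)
  then show ?thesis using assms by simp
qed

lemma gaussian_moment_scale:
  assumes "a > 0"
  shows "(\<integral>t. exp (- (a * t\<^sup>2 / 2)) * t ^ j * cos (t * y) \<partial>lborel) =
           (\<integral>u. exp (- (u\<^sup>2) / 2) * u ^ j * cos (u * (y / sqrt a)) \<partial>lborel) / sqrt a ^ Suc j"
proof -
  have "(\<integral>u. exp (- (u\<^sup>2) / 2) * u ^ j * cos (u * (y / sqrt a)) \<partial>lborel) =
          sqrt a * (\<integral>t. exp (- ((sqrt a * t)\<^sup>2) / 2) * (sqrt a * t) ^ j * cos (sqrt a * t * (y / sqrt a)) \<partial>lborel)"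
    by (subst lborel_integral_real_affine[of "sqrt a" _ 0]) (use assms in auto)
  also have "\<dots> = sqrt a * (\<integral>t. sqrt a ^ j * (exp (- (a * t\<^sup>2 / 2)) * t ^ j * cos (t * y)) \<partial>lborel)"
    using assms by (simp add: power_mult_distrib mult_ac)
  also have "\<dots> = sqrt a ^ Suc j * (\<integral>t. exp (- (a * t\<^sup>2 / 2)) * t ^ j * cos (t * y) \<partial>lborel)"
    by simp
  finally show ?thesis using assms by (simp add: field_simps)
qed

section \<open>Taylor terms as Hermite sums\<close>

lemma exp_coeff_scale:
  "exp_coeff (\<lambda>m. v * a m) \<nu> =
     (\<Sum>kv\<in>partition_tuples \<nu>. v ^ (\<Sum>m=1..\<nu>. kv m) * (\<Prod>m=1..\<nu>. a m ^ kv m / fact (kv m)))"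
  unfolding exp_coeff_def
  by (simp add: power_mult_distrib power_sum flip: prod.distrib)

text \<open>Each factor contributes \<open>(-1) ^ (m + 1)\<close> and one half, to the power
  \<open>kv m\<close>. As the tuple has weight \<open>\<nu>\<close>, the signs collect to
  \<open>(-1) ^ (\<nu> + s)\<close>, which later cancels the sign from
  \<open>hermite_even_fourier\<close>.\<close>

lemma prod_log_char_coeff:
  assumes "kv \<in> partition_tuples \<nu>"
  defines "s \<equiv> \<Sum>m=1..\<nu>. kv m"
  shows "(\<Prod>m=1..\<nu>. log_char_coeff q m ^ kv m / fact (kv m)) =
           (-1) ^ (\<nu> + s) * (1 / 2) ^ s *
           (\<Prod>m=1..\<nu>. 1 / fact (kv m) *
             (bernoulli_num (2 * (m + 1)) * ((real q + 1) ^ (2 * m + 2) - 1)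
               / (fact (2 * m + 2) * real (m + 1))) ^ kv m)"
proof -
  define b where "b = (\<lambda>m. bernoulli_num (2 * (m + 1)) * ((real q + 1) ^ (2 * m + 2) - 1)
               / (fact (2 * m + 2) * real (m + 1)))"
  have c: "log_char_coeff q m = (-1) ^ (m + 1) * ((1 / 2) * b m)" for m
  proof -
    have "A * x * y / (f * (2 * r)) = A * (1 / 2 * (x * y / (f * r)))" for A x y f r :: real
      by simp
    moreover have "real (2 * m + 2) = 2 * real (m + 1)" "2 * (m + 1) = 2 * m + 2" by simp_all
    ultimately show ?thesis
      unfolding log_char_coeff_def b_def by (simp only: Suc_eq_plus1 add.commute[of 1 "real q"])
  qed
  have "(\<Prod>m=1..\<nu>. log_char_coeff q m ^ kv m / fact (kv m)) =
          (\<Prod>m=1..\<nu>. (-1) ^ ((m + 1) * kv m) * ((1 / 2) ^ kv m * (1 / fact (kv m) * b m ^ kv m)))"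
    unfolding c power_mult_distrib power_mult by simp
  also have "\<dots> = (-1) ^ (\<Sum>m=1..\<nu>. (m + 1) * kv m) * ((1 / 2) ^ s * (\<Prod>m=1..\<nu>. 1 / fact (kv m) * b m ^ kv m))"
    by (simp only: prod.distrib power_sum s_def)
  also have "(\<Sum>m=1..\<nu>. (m + 1) * kv m) = \<nu> + s"
    using assms(1) by (simp add: s_def partition_tuples_def sum.distrib)
  finally show ?thesis by (simp add: b_def)
qed

text \<open>A tuple with entry sum \<open>S kv\<close> turns \<open>t ^ (2 * \<nu>)\<close> into a
  Gaussian moment of order \<open>2 * (\<nu> + S kv)\<close>, whose Fourier integral is a Hermite
  term.\<close>

lemma q_coeff_eq_integral:
  assumes q: "q \<ge> 1" and n: "n > 0"
  defines "s \<equiv> real q * (real q + 2) / 12"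
  shows "integrable lborel (\<lambda>t. exp (- (s * (real n * t\<^sup>2) / 2)) *
              (exp_coeff (\<lambda>m. real n * t\<^sup>2 * log_char_coeff q m) \<nu> * t ^ (2 * \<nu>)) * cos (t * y))"
    and "q_coeff q \<nu> (y / sqrt (s * real n)) / real n ^ \<nu> =
           sqrt (s * real n) / (2 * pi) *
           (\<integral>t. exp (- (s * (real n * t\<^sup>2) / 2)) *
              (exp_coeff (\<lambda>m. real n * t\<^sup>2 * log_char_coeff q m) \<nu> * t ^ (2 * \<nu>)) * cos (t * y) \<partial>lborel)"
proof -
  define a where "a = s * real n"
  have s: "s > 0" using q by (simp add: s_def)
  then have a: "a > 0" using n by (simp add: a_def)
  define x where "x = y / sqrt a"
  define S where "S = (\<lambda>kv. \<Sum>m=1..\<nu>. kv m :: nat)"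
  define W where "W = (\<lambda>kv. \<Prod>m=1..\<nu>. log_char_coeff q m ^ kv m / fact (kv m))"
  define I where "I = (\<lambda>j t. exp (- (a * t\<^sup>2 / 2)) * t ^ (2 * j) * cos (t * y))"
  have int: "integrable lborel (I j)" for j
    unfolding I_def
    by (rule Bochner_Integration.integrable_bound[OF integrable_gaussian_moment[OF a, of "2 * j"]])
       (auto intro!: mult_left_le simp: abs_mult)
  have I: "(\<integral>t. I j t \<partial>lborel) =
             sqrt (2 * pi) * (-1) ^ j * exp (- (x\<^sup>2) / 2) * hermite (2 * j) x / (sqrt a * a ^ j)" for j
  proof -
    have "sqrt a ^ Suc (2 * j) = sqrt a * a ^ j"
      using a by (simp add: power_mult)
    then show ?thesis
      unfolding I_def gaussian_moment_scale[OF a] x_def[symmetric] hermite_even_fourier by simp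
  qed
  have eq: "exp (- (s * (real n * t\<^sup>2) / 2)) *
              (exp_coeff (\<lambda>m. real n * t\<^sup>2 * log_char_coeff q m) \<nu> * t ^ (2 * \<nu>)) * cos (t * y) =
            (\<Sum>kv\<in>partition_tuples \<nu>. real n ^ S kv * W kv * I (\<nu> + S kv) t)" for t
  proof -
    have "(real n * t\<^sup>2) ^ S kv * W kv * t ^ (2 * \<nu>) = real n ^ S kv * W kv * t ^ (2 * (\<nu> + S kv))" for kv
      by (simp add: power_mult_distrib power_add power_mult distrib_left)
    moreover have "exp_coeff (\<lambda>m. real n * t\<^sup>2 * log_char_coeff q m) \<nu> =
            (\<Sum>kv\<in>partition_tuples \<nu>. (real n * t\<^sup>2) ^ S kv * W kv)"
      by (simp only: exp_coeff_scale S_def W_def)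
    ultimately have "exp_coeff (\<lambda>m. real n * t\<^sup>2 * log_char_coeff q m) \<nu> * t ^ (2 * \<nu>) =
            (\<Sum>kv\<in>partition_tuples \<nu>. real n ^ S kv * W kv * t ^ (2 * (\<nu> + S kv)))"
      by (simp only: sum_distrib_right)
    then show ?thesis
      by (simp only: sum_distrib_left sum_distrib_right) (simp add: I_def a_def mult_ac)
  qed
  show "integrable lborel (\<lambda>t. exp (- (s * (real n * t\<^sup>2) / 2)) *
              (exp_coeff (\<lambda>m. real n * t\<^sup>2 * log_char_coeff q m) \<nu> * t ^ (2 * \<nu>)) * cos (t * y))"
    unfolding eq by (intro Bochner_Integration.integrable_sum integrable_mult_right int)
  have "sqrt a / (2 * pi) * (\<integral>t. exp (- (s * (real n * t\<^sup>2) / 2)) *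
              (exp_coeff (\<lambda>m. real n * t\<^sup>2 * log_char_coeff q m) \<nu> * t ^ (2 * \<nu>)) * cos (t * y) \<partial>lborel) =
          (\<Sum>kv\<in>partition_tuples \<nu>. sqrt a / (2 * pi) * (real n ^ S kv * W kv * (\<integral>t. I (\<nu> + S kv) t \<partial>lborel)))"
    unfolding eq sum_distrib_left[symmetric]
    by (subst Bochner_Integration.integral_sum) (auto intro!: integrable_mult_right int)
  also have "\<dots> = (\<Sum>kv\<in>partition_tuples \<nu>. 1 / sqrt (2 * pi) * (1 / s) ^ \<nu> * exp (- (x\<^sup>2) / 2) *
          (hermite (2 * (\<nu> + S kv)) x * (1 / (2 * s)) ^ S kv *
          (\<Prod>m=1..\<nu>. 1 / fact (kv m) *
             (bernoulli_num (2 * (m + 1)) * ((real q + 1) ^ (2 * m + 2) - 1)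
               / (fact (2 * m + 2) * real (m + 1))) ^ kv m)) / real n ^ \<nu>)"
  proof (intro sum.cong refl)
    fix kv assume kv: "kv \<in> partition_tuples \<nu>"
    define B where "B = (\<Prod>m=1..\<nu>. 1 / fact (kv m) *
             (bernoulli_num (2 * (m + 1)) * ((real q + 1) ^ (2 * m + 2) - 1)
               / (fact (2 * m + 2) * real (m + 1))) ^ kv m)"
    have W: "W kv = (-1) ^ (\<nu> + S kv) * (1 / 2) ^ S kv * B"
      unfolding W_def S_def B_def by (rule prod_log_char_coeff[OF kv])
    have sign: "(-1) ^ (\<nu> + S kv) * (-1) ^ (\<nu> + S kv) = (1 :: real)"
      by (simp flip: power_mult_distrib)
    have pi: "sqrt (2 * pi) / (2 * pi) = 1 / sqrt (2 * pi)"
      by (simp add: real_div_sqrt field_simps)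
    have "sqrt a / (2 * pi) * (real n ^ S kv * W kv * (\<integral>t. I (\<nu> + S kv) t \<partial>lborel)) =
       ((-1) ^ (\<nu> + S kv) * (-1) ^ (\<nu> + S kv)) * (sqrt (2 * pi) / (2 * pi)) * (sqrt a / sqrt a) *
       (real n ^ S kv * (1 / 2) ^ S kv / a ^ (\<nu> + S kv)) * exp (- (x\<^sup>2) / 2) * hermite (2 * (\<nu> + S kv)) x * B"
      unfolding I W by (simp add: mult_ac)
    also have "\<dots> = 1 / sqrt (2 * pi) * (real n ^ S kv * (1 / 2) ^ S kv / a ^ (\<nu> + S kv)) *
        exp (- (x\<^sup>2) / 2) * hermite (2 * (\<nu> + S kv)) x * B"
      unfolding sign pi using a by simp
    \<comment> \<open>The powers of \<open>n\<close> coming from \<open>S kv\<close> cancel, so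
      every tuple contributes at the same order \<open>1 / n ^ \<nu>\<close>.\<close>
    also have "real n ^ S kv * (1 / 2) ^ S kv / a ^ (\<nu> + S kv) = (1 / s) ^ \<nu> * (1 / (2 * s)) ^ S kv / real n ^ \<nu>"
      using n s by (simp add: a_def power_add power_mult_distrib power_divide field_simps)
    finally show "sqrt a / (2 * pi) * (real n ^ S kv * W kv * (\<integral>t. I (\<nu> + S kv) t \<partial>lborel)) =
       1 / sqrt (2 * pi) * (1 / s) ^ \<nu> * exp (- (x\<^sup>2) / 2) *
          (hermite (2 * (\<nu> + S kv)) x * (1 / (2 * s)) ^ S kv * B) / real n ^ \<nu>"
      by (simp add: mult_ac)
  qed
  also have "\<dots> = q_coeff q \<nu> x / real n ^ \<nu>"
  proof -
    have inv_s: "1 / s = 12 / (real q * (real q + 2))" "1 / (2 * s) = 6 / (real q * (real q + 2))"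
      by (simp_all add: s_def)
    then show ?thesis
      unfolding q_coeff_def Let_def S_def sum_distrib_left sum_divide_distrib inv_s by simp
  qed
  finally show "q_coeff q \<nu> (y / sqrt (s * real n)) / real n ^ \<nu> =
           sqrt (s * real n) / (2 * pi) *
           (\<integral>t. exp (- (s * (real n * t\<^sup>2) / 2)) *
              (exp_coeff (\<lambda>m. real n * t\<^sup>2 * log_char_coeff q m) \<nu> * t ^ (2 * \<nu>)) * cos (t * y) \<partial>lborel)"
    by (simp add: x_def a_def)
qed

section \<open>The local limit expansion\<close>

text \<open>The leading Gaussian is the term \<open>\<nu> = 0\<close>, so the expansion can be
  handled as one sum over \<open>{..M}\<close>.\<close>

lemma q_coeff_0: "q_coeff q 0 x = 1 / sqrt (2 * pi) * exp (- (x\<^sup>2) / 2)"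
proof -
  have "partition_tuples 0 = {\<lambda>_. 0}" by (auto simp: partition_tuples_def)
  then show ?thesis by (simp add: q_coeff_def hermite_0)
qed

text \<open>The pointwise estimate is integrated against \<open>cos (t * y)\<close>. Since
  \<open>k\<close> enters only through this cosine, bounded by 1, the error is uniform in
  \<open>k\<close>.\<close>

lemma local_limit_error_bound:
  fixes q M :: nat
  assumes q: "q \<ge> 1"
  defines "s \<equiv> real q * (real q + 2) / 12"
  obtains K \<rho> where "0 < \<rho>" "\<rho> < 1"
    "\<And>n k. n > 0 \<Longrightarrow>
       \<bar>sqrt (s * real n) * (1 / (1 + real q) ^ n * ext_binom q n k) -
         (\<Sum>\<nu>\<le>M. q_coeff q \<nu> ((real_of_int k - real q / 2 * real n) / sqrt (s * real n)) / real n ^ \<nu>)\<bar>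
       \<le> K / real n ^ (M + 1) + sqrt (s * real n) * \<rho> ^ n"
proof -
  have s: "s > 0" using q by (simp add: s_def)
  obtain C \<rho> where C: "0 \<le> C" and \<rho>: "0 < \<rho>" "\<rho> < 1" and bound:
    "\<And>n t. \<bar>indicator {-pi..pi} t * unif_char q t ^ n - exp (- (s * (real n * t\<^sup>2) / 2)) *
               (\<Sum>\<nu>\<le>M. exp_coeff (\<lambda>m. real n * t\<^sup>2 * log_char_coeff q m) \<nu> * t ^ (2 * \<nu>))\<bar>
           \<le> C * (exp (- (s * (real n * t\<^sup>2) / 4)) * t ^ (2 * M + 2)) + indicator {-pi..pi} t * \<rho> ^ n"
    using unif_char_power_expansion[OF q, of M] unfolding s_def by blast
  define A where "A = (\<integral>u. exp (- (u\<^sup>2) / 2) * u ^ (2 * M + 2) \<partial>lborel :: real)"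
  define K where "K = C * A * sqrt 2 * (2 / s) ^ (M + 1) / (2 * pi)"
  show ?thesis
  proof (rule that[of \<rho> K])
    fix n :: nat and k :: int
    assume n: "n > 0"
    define y where "y = real_of_int k - real q / 2 * real n"
    define a where "a = s * real n"
    have a: "a > 0" using s n by (simp add: a_def)
    define f where "f = (\<lambda>t. indicator {-pi..pi} t * (unif_char q t ^ n * cos (t * y)) :: real)"
    define g where "g = (\<lambda>\<nu> t. exp (- (s * (real n * t\<^sup>2) / 2)) *
              (exp_coeff (\<lambda>m. real n * t\<^sup>2 * log_char_coeff q m) \<nu> * t ^ (2 * \<nu>)) * cos (t * y))"
    define h where "h = (\<lambda>t. C * (exp (- (a / 2 * t\<^sup>2 / 2)) * t ^ (2 * M + 2)) + indicator {-pi..pi} t * \<rho> ^ n)"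
    have int_f: "integrable lborel f"
    proof -
      have "continuous_on {-pi..pi} (\<lambda>t. unif_char q t ^ n * cos (t * y))"
        by (intro continuous_intros)
      from borel_integrable_atLeastAtMost'[OF this] show ?thesis
        by (simp add: set_integrable_def f_def)
    qed
    have int_g: "integrable lborel (g \<nu>)" for \<nu>
      using q_coeff_eq_integral(1)[OF q n] unfolding g_def s_def by blast
    have int_gauss: "integrable lborel (\<lambda>t. exp (- (a / 2 * t\<^sup>2 / 2)) * t ^ (2 * M + 2))"
      using a by (intro integrable_gaussian_moment) auto
    have int_h: "integrable lborel h"
      unfolding h_def
      by (intro Bochner_Integration.integrable_add integrable_mult_right int_gauss integrable_mult_left) auto
    have P: "1 / (1 + real q) ^ n * ext_binom q n k = (\<integral>t. f t \<partial>lborel) / (2 * pi)"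
      unfolding f_def y_def by (rule ext_binom_fourier)
    have Q: "q_coeff q \<nu> (y / sqrt a) / real n ^ \<nu> = sqrt a / (2 * pi) * (\<integral>t. g \<nu> t \<partial>lborel)" for \<nu>
      unfolding g_def a_def s_def by (rule q_coeff_eq_integral(2)[OF q n])
    have "sqrt a * (1 / (1 + real q) ^ n * ext_binom q n k) - (\<Sum>\<nu>\<le>M. q_coeff q \<nu> (y / sqrt a) / real n ^ \<nu>) =
            sqrt a / (2 * pi) * ((\<integral>t. f t \<partial>lborel) - (\<Sum>\<nu>\<le>M. \<integral>t. g \<nu> t \<partial>lborel))"
      unfolding P Q by (simp add: sum_distrib_left right_diff_distrib)
    also have "(\<integral>t. f t \<partial>lborel) - (\<Sum>\<nu>\<le>M. \<integral>t. g \<nu> t \<partial>lborel) = (\<integral>t. f t - (\<Sum>\<nu>\<le>M. g \<nu> t) \<partial>lborel)"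
      by (simp add: int_f int_g)
    also have "\<bar>sqrt a / (2 * pi) * \<dots>\<bar> = sqrt a / (2 * pi) * \<bar>\<integral>t. f t - (\<Sum>\<nu>\<le>M. g \<nu> t) \<partial>lborel\<bar>"
      using a by (simp add: abs_mult)
    also have "\<dots> \<le> sqrt a / (2 * pi) * (\<integral>t. h t \<partial>lborel)"
    proof (rule mult_left_mono)
      show "\<bar>\<integral>t. f t - (\<Sum>\<nu>\<le>M. g \<nu> t) \<partial>lborel\<bar> \<le> (\<integral>t. h t \<partial>lborel)"
      proof (rule order_trans[OF integral_abs_bound Bochner_Integration.integral_mono])
        fix t :: real
        have "f t - (\<Sum>\<nu>\<le>M. g \<nu> t) =
            (indicator {-pi..pi} t * unif_char q t ^ n - exp (- (s * (real n * t\<^sup>2) / 2)) *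
               (\<Sum>\<nu>\<le>M. exp_coeff (\<lambda>m. real n * t\<^sup>2 * log_char_coeff q m) \<nu> * t ^ (2 * \<nu>))) * cos (t * y)"
          by (simp add: f_def g_def left_diff_distrib sum_distrib_left sum_distrib_right mult.assoc)
        also have "\<bar>\<dots>\<bar> \<le> \<bar>indicator {-pi..pi} t * unif_char q t ^ n - exp (- (s * (real n * t\<^sup>2) / 2)) *
               (\<Sum>\<nu>\<le>M. exp_coeff (\<lambda>m. real n * t\<^sup>2 * log_char_coeff q m) \<nu> * t ^ (2 * \<nu>))\<bar>"
          unfolding abs_mult[of _ "cos (t * y)"] by (rule mult_left_le) auto
        also have "\<dots> \<le> h t"
          using bound[of t n] by (simp add: h_def a_def mult.assoc)
        finally show "\<bar>f t - (\<Sum>\<nu>\<le>M. g \<nu> t)\<bar> \<le> h t" .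
      qed (intro integrable_abs Bochner_Integration.integrable_diff Bochner_Integration.integrable_sum int_f int_g int_h)+
    qed (use a in simp)
    \<comment> \<open>The weakened Gaussian in \<open>h\<close> has parameter \<open>a / 2\<close>.
      Its moment is of order \<open>n powr (- M - 3 / 2)\<close>, and the prefactor
      \<open>sqrt a\<close> raises this to \<open>1 / n ^ (M + 1)\<close>.\<close>
    also have "(\<integral>t. h t \<partial>lborel) = C * (A / sqrt (a / 2) ^ Suc (2 * M + 2)) + 2 * pi * \<rho> ^ n"
    proof -
      have "(\<integral>t. h t \<partial>lborel) = C * (\<integral>t. exp (- (a / 2 * t\<^sup>2 / 2)) * t ^ (2 * M + 2) \<partial>lborel)
               + (\<integral>t. indicator {-pi..pi} t * \<rho> ^ n \<partial>lborel)"
        unfolding h_def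
        by (subst Bochner_Integration.integral_add)
           (intro integrable_mult_right int_gauss, intro integrable_mult_left, simp,
            simp only: integral_mult_right_zero)
      also have "(\<integral>t. exp (- (a / 2 * t\<^sup>2 / 2)) * t ^ (2 * M + 2) \<partial>lborel) = A / sqrt (a / 2) ^ Suc (2 * M + 2)"
        using gaussian_moment_scale[of "a / 2" "2 * M + 2" 0] a by (simp add: A_def)
      also have "(\<integral>t. indicator {-pi..pi} t * \<rho> ^ n \<partial>lborel) = 2 * pi * \<rho> ^ n" by simp
      finally show ?thesis .
    qed
    also have "sqrt a / (2 * pi) * (C * (A / sqrt (a / 2) ^ Suc (2 * M + 2)) + 2 * pi * \<rho> ^ n) =
                 K / real n ^ (M + 1) + sqrt a * \<rho> ^ n"
    proof -
      have "sqrt (a / 2) ^ Suc (2 * M + 2) = sqrt (a / 2) * (sqrt (a / 2))\<^sup>2 ^ (M + 1)"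
        unfolding power_mult[symmetric] by simp
      also have "\<dots> = sqrt a / sqrt 2 * (s / 2 * real n) ^ (M + 1)"
      proof -
        have "(sqrt (a / 2))\<^sup>2 = s / 2 * real n" using a by (simp add: a_def)
        then show ?thesis by (simp only: real_sqrt_divide)
      qed
      finally have "sqrt a / (2 * pi) * (C * (A / sqrt (a / 2) ^ Suc (2 * M + 2))) =
              sqrt a / (2 * pi) * (C * (A / (sqrt a / sqrt 2 * (s / 2 * real n) ^ (M + 1))))"
        by (simp only:)
      also have "\<dots> = K / real n ^ (M + 1)"
        using a s n by (simp add: K_def power_mult_distrib power_divide field_simps)
      finally show ?thesis by (simp add: distrib_left)
    qed
    finally show "\<bar>sqrt (s * real n) * (1 / (1 + real q) ^ n * ext_binom q n k) -
         (\<Sum>\<nu>\<le>M. q_coeff q \<nu> ((real_of_int k - real q / 2 * real n) / sqrt (s * real n)) / real n ^ \<nu>)\<bar>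
       \<le> K / real n ^ (M + 1) + sqrt (s * real n) * \<rho> ^ n"
      by (simp only: a_def y_def)
  qed (use \<rho> in auto)
qed

text \<open>After multiplication by \<open>n powr p\<close> the first term vanishes because
  \<open>p < M + 1\<close>, the second because geometric decay beats every power.\<close>

lemma eventually_error_le:
  fixes K s \<rho> p \<epsilon> :: real
  assumes "0 < \<rho>" "\<rho> < 1" "p < real M + 1" "0 < s" "0 < \<epsilon>"
  shows "\<forall>\<^sub>F n in sequentially. K / real n ^ (M + 1) + sqrt (s * real n) * \<rho> ^ n \<le> \<epsilon> / real n powr p"
proof -
  have "(\<lambda>n. K * real n powr (p - (real M + 1)) + sqrt (s * real n) * \<rho> ^ n * real n powr p) \<longlonglongrightarrow> K * 0 + 0"
  proof (intro tendsto_add tendsto_mult tendsto_const)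
    show "(\<lambda>n. real n powr (p - (real M + 1))) \<longlonglongrightarrow> 0"
      using assms by (intro tendsto_neg_powr filterlim_real_sequentially) auto
    show "(\<lambda>n. sqrt (s * real n) * \<rho> ^ n * real n powr p) \<longlonglongrightarrow> 0"
      using assms by real_asymp
  qed
  then have "\<forall>\<^sub>F n in sequentially. K * real n powr (p - (real M + 1)) + sqrt (s * real n) * \<rho> ^ n * real n powr p < \<epsilon>"
    using assms by (intro order_tendstoD) auto
  with eventually_gt_at_top[of 0] show ?thesis
  proof eventually_elim
    case (elim n)
    have "real n powr (p - (real M + 1)) = real n powr p / real n ^ (M + 1)"
      using elim(1) by (simp add: powr_diff powr_add powr_realpow)
    then have "(K / real n ^ (M + 1) + sqrt (s * real n) * \<rho> ^ n) * real n powr p \<le> \<epsilon>"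
      using elim(2) by (simp add: distrib_right)
    then show ?case using elim(1) by (simp add: pos_le_divide_eq)
  qed
qed

theorem theorem1:
  fixes q N :: nat
  assumes "q \<ge> 1" and "N \<ge> 2"
  shows "\<forall>\<epsilon>>0. \<forall>\<^sub>F n in sequentially. \<forall>k::int.
           \<bar>sqrt (real q * (real q + 2) * real n / 12) * (1 / (1 + real q) ^ n) * ext_binom q n k
             - (let x = sqrt 12 / sqrt (real q * (real q + 2) * real n) * (real_of_int k - real q / 2 * real n)
                in 1 / sqrt (2 * pi) * exp (- (x^2) / 2)
                   + (\<Sum>\<nu>=1..(N - 2) div 2. q_coeff q \<nu> x / real n ^ \<nu>))\<bar>
           \<le> \<epsilon> / real n powr ((real N - 2) / 2)"
proof (intro allI impI)
  fix \<epsilon> :: real assume \<epsilon>: "\<epsilon> > 0"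
  define M where "M = (N - 2) div 2"
  define s where "s = real q * (real q + 2) / 12"
  have s: "s > 0" using assms by (simp add: s_def)
  obtain K \<rho> where \<rho>: "0 < \<rho>" "\<rho> < 1" and bound: "\<And>n k. n > 0 \<Longrightarrow>
       \<bar>sqrt (s * real n) * (1 / (1 + real q) ^ n * ext_binom q n k) -
         (\<Sum>\<nu>\<le>M. q_coeff q \<nu> ((real_of_int k - real q / 2 * real n) / sqrt (s * real n)) / real n ^ \<nu>)\<bar>
       \<le> K / real n ^ (M + 1) + sqrt (s * real n) * \<rho> ^ n"
    by (rule local_limit_error_bound[OF assms(1), of M, folded s_def]) (assumption | rule that)+
  \<comment> \<open>Strict for both parities of \<open>N\<close>; this strictness turns the bound of
    order \<open>1 / n ^ (M + 1)\<close> into a little-o.\<close>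
  have "N - 2 < 2 * (M + 1)" unfolding M_def by presburger
  then have "real (N - 2) < real (2 * (M + 1))" by (simp only: of_nat_less_iff)
  then have p: "(real N - 2) / 2 < real M + 1" using assms(2) by (simp add: of_nat_diff)
  show "\<forall>\<^sub>F n in sequentially. \<forall>k::int.
           \<bar>sqrt (real q * (real q + 2) * real n / 12) * (1 / (1 + real q) ^ n) * ext_binom q n k
             - (let x = sqrt 12 / sqrt (real q * (real q + 2) * real n) * (real_of_int k - real q / 2 * real n)
                in 1 / sqrt (2 * pi) * exp (- (x^2) / 2)
                   + (\<Sum>\<nu>=1..(N - 2) div 2. q_coeff q \<nu> x / real n ^ \<nu>))\<bar>
           \<le> \<epsilon> / real n powr ((real N - 2) / 2)"
    \<comment> \<open>The threshold for \<open>n\<close> is fixed before \<open>k\<close> is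
      introduced, which gives uniformity.\<close>
    using eventually_error_le[OF \<rho> p s \<epsilon>, where K = K] eventually_gt_at_top[of "0 :: nat"]
  proof eventually_elim
    case (elim n)
    show ?case
    proof
      fix k :: int
      define x where "x = sqrt 12 / sqrt (real q * (real q + 2) * real n) * (real_of_int k - real q / 2 * real n)"
      have "sqrt (s * real n) = sqrt (real q * (real q + 2) * real n) / sqrt 12"
        by (simp add: s_def flip: real_sqrt_divide)
      then have x: "x = (real_of_int k - real q / 2 * real n) / sqrt (s * real n)"
        by (simp add: x_def)
      have "{..M} = insert 0 {1..M}" by auto
      then have "(\<Sum>\<nu>\<le>M. q_coeff q \<nu> x / real n ^ \<nu>) =
              1 / sqrt (2 * pi) * exp (- (x\<^sup>2) / 2) + (\<Sum>\<nu>=1..M. q_coeff q \<nu> x / real n ^ \<nu>)"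
        by (simp add: q_coeff_0)
      moreover have "sqrt (s * real n) = sqrt (real q * (real q + 2) * real n / 12)"
        by (simp add: s_def)
      ultimately show "\<bar>sqrt (real q * (real q + 2) * real n / 12) * (1 / (1 + real q) ^ n) * ext_binom q n k
             - (let x = sqrt 12 / sqrt (real q * (real q + 2) * real n) * (real_of_int k - real q / 2 * real n)
                in 1 / sqrt (2 * pi) * exp (- (x^2) / 2)
                   + (\<Sum>\<nu>=1..(N - 2) div 2. q_coeff q \<nu> x / real n ^ \<nu>))\<bar>
           \<le> \<epsilon> / real n powr ((real N - 2) / 2)"
        using order_trans[OF bound[OF elim(2), of k] elim(1)]
        unfolding Let_def x_def[symmetric] M_def[symmetric] x[symmetric] by (simp only: mult.assoc)
    qed
  qed
qed

end
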